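(* There are absolute constants $c,C>0$ such that the following holds. Let $A$ be a finite subset of an abelian group. Suppose that $\mathsf{E}(A)=|A|^3/K$. Then there exists a set $B\subseteq A$ such that $$|B|\ge c\,|A|/K^{25/8}\qquad\text{and}\qquad \dim(B)\le C\,K^{7/8}\log|A|.$$
   Context: The additive energy is $\mathsf{E}(A)=|\{(a_1,a_2,a_3,a_4)\in A^4 : a_1+a_2=a_3+a_4\}|$. All logarithms are to base $2$. A finite subset $\Lambda$ of an abelian group is dissociated if $\sum_{\lambda\in\Lambda}\varepsilon_\lambda\lambda=0$ with all $\varepsilon_\lambda\in\{-1,0,1\}$ implies $\varepsilon_\lambda=0$ for all $\lambda$. For a finite set $B$, $\dim(B)$ is the maximal cardinality of a dissociated subset of $B$.
   Formalization: The formal statement assumes |A| ≥ 2: for A = {a} with a ≠ 0 one has K = 1 and log|A| = 0, so the bound dim(B) ≤ C K^{7/8} log|A| fails for the only admissible B = A, and log|A| is undefined for empty A. *)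

theory Defs
  imports "HOL-Algebra.Algebra" Complex_Main
begin

text \<open>Abelian groups are \<^const>\<open>comm_group\<close> structures, hence written multiplicatively:
  the sum of \<open>x\<close> and \<open>y\<close> is \<open>x \<otimes> y\<close>, and the multiple of \<open>x\<close> by the integer
  \<open>k\<close> is \<open>x [^] k\<close>.\<close>

definition additive_energy :: "('a, 'b) monoid_scheme \<Rightarrow> 'a set \<Rightarrow> nat" where
  "additive_energy G A =
     card {(a1, a2, a3, a4). a1 \<in> A \<and> a2 \<in> A \<and> a3 \<in> A \<and> a4 \<in> A \<and>
             a1 \<otimes>\<^bsub>G\<^esub> a2 = a3 \<otimes>\<^bsub>G\<^esub> a4}"

definition dissociated :: "('a, 'b) monoid_scheme \<Rightarrow> 'a set \<Rightarrow> bool" where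
  "dissociated G L \<longleftrightarrow> finite L \<and> L \<subseteq> carrier G \<and>
     (\<forall>e :: 'a \<Rightarrow> int. (\<forall>x\<in>L. e x \<in> {-1, 0, 1}) \<and>
        finprod G (\<lambda>x. x [^]\<^bsub>G\<^esub> e x) L = \<one>\<^bsub>G\<^esub> \<longrightarrow> (\<forall>x\<in>L. e x = 0))"

definition additive_dim :: "('a, 'b) monoid_scheme \<Rightarrow> 'a set \<Rightarrow> nat" where
  "additive_dim G B = Max {card L | L. L \<subseteq> B \<and> dissociated G L}"

text \<open>The bounds hold, with constants \<open>c\<close> and \<open>C\<close>, for all abelian groups whose carrier is
  a set of elements of the given type.  The case of at most one element is excluded because
  \<open>log 2 0\<close> is meaningless and \<open>log 2 1 = 0\<close>: for \<open>A = {a}\<close> with \<open>a\<close> not neutral, every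
  nonempty \<open>B \<subseteq> A\<close> has dimension 1, so the second bound fails.  The energy hypothesis then
  forces \<open>K \<ge> 1\<close>.\<close>

definition energy_dim_bounds :: "'a itself \<Rightarrow> real \<Rightarrow> real \<Rightarrow> bool" where
  "energy_dim_bounds TYPE('a) c C \<longleftrightarrow>
     (\<forall>(G :: 'a monoid) (A :: 'a set) (K :: real).
        comm_group G \<and> A \<subseteq> carrier G \<and> finite A \<and> card A \<ge> 2 \<and>
        real (additive_energy G A) = real (card A) ^ 3 / K \<longrightarrow>
        (\<exists>B \<subseteq> A. real (card B) \<ge> c * real (card A) / K powr (25 / 8) \<and>
                  real (additive_dim G B) \<le> C * K powr (7 / 8) * log 2 (real (card A))))"

text \<open>\<open>\<exists>c C. energy_dim_bounds TYPE('a) c C\<close> alone would let the constants depend on the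
  type \<open>'a\<close>, and HOL cannot quantify over types below an existential quantifier.
  Absoluteness of the constants is therefore expressed by asking for constants that work for
  \<open>TYPE(nat)\<close> and asking that any constants that work for \<open>TYPE(nat)\<close> also work for
  every type \<open>'a\<close>; thus one fixed pair serves all abelian groups.  The second requirement is
  no restriction, since the subgroup generated by a finite set is countable and so isomorphic
  to a group carried by a set of natural numbers.\<close>

end

theory Submission
  imports Defs "HOL-Combinatorics.Multiset_Permutations" "HOL-Analysis.L2_Norm"
    "HOL-Library.Countable_Set"
begin

text \<open>If every subset of \<open>A\<close> of size at least \<open>m\<close> contained a dissociated set of size \<open>D\<close>,
  then any \<open>V \<subseteq> A\<close> would be a union of dissociated sets up to \<open>m\<close> elements. By Rudin's
  inequality (a moment bound obtained by counting coincidences between words over a dissociated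
  set) the convolution of any \<open>f\<close> with \<open>V\<close> would then satisfy
  \<open>|f * V|\<^sup>2 \<le> |f|\<^sup>2 (|V|\<^sup>2 / M + 2 m\<^sup>2)\<close> with \<open>M\<close> a large multiple of \<open>K powr (7 / 8)\<close>.

  Write \<open>r\<close> for the number of representations as a difference in \<open>A\<close>, and
  \<open>A\<^sub>x = A \<inter> (A - x)\<close>. If half of the energy comes from \<open>r \<le> |A| / K powr (3 / 4)\<close>, then, \<open>r\<close>
  being positive semidefinite, the triangles \<open>r(x) r(y) r(x - y) |A\<^sub>x \<inter> A\<^sub>y|\<close> with \<open>r(x)\<close>, \<open>r(y)\<close>
  so truncated have total weight at least of order \<open>|A|\<^sup>6 / K\<^sup>3\<close>, while Cauchy-Schwarz and the
  convolution inequality, applied to \<open>A\<close> and to the slices \<open>A\<^sub>x\<close>, make it smaller. Otherwise some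
  slice \<open>V = A\<^sub>x\<close> has more than \<open>|A| / K powr (3 / 4)\<close> elements and most differences of pairs in
  \<open>V\<close> lie in a set of size \<open>O(K |A|)\<close>. Counting triples of \<open>V\<close> all of whose differences are
  popular, with weights \<open>1 / sqrt (r(x) r(y))\<close> in Cauchy-Schwarz, then bounds \<open>M\<^sup>2\<close> by a multiple
  of \<open>K |A| / |V|\<close>, which is less than \<open>K powr (7 / 4)\<close>.\<close>

section \<open>Words over dissociated sets\<close>

lemma sum_Times: "(\<Sum>z\<in>A \<times> B. g z) = (\<Sum>x\<in>A. \<Sum>y\<in>B. g (x, y))"
  by (simp add: sum.cartesian_product)

lemma sum_le_fibres:
  fixes g :: "'b \<Rightarrow> real"
  assumes "finite H" "finite Y" "\<phi> ` H \<subseteq> Y" "\<And>y. y \<in> Y \<Longrightarrow> g y \<ge> 0"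
    and "\<And>y. y \<in> Y \<Longrightarrow> real (card {h \<in> H. \<phi> h = y}) \<le> N"
  shows "(\<Sum>h\<in>H. g (\<phi> h)) \<le> N * (\<Sum>y\<in>Y. g y)"
proof -
  have "(\<Sum>h\<in>H. g (\<phi> h)) = (\<Sum>y\<in>Y. \<Sum>h\<in>{h\<in>H. \<phi> h = y}. g (\<phi> h))"
    by (rule sum.group[OF assms(1-3), symmetric])
  also have "\<dots> = (\<Sum>y\<in>Y. real (card {h\<in>H. \<phi> h = y}) * g y)"
  proof (rule sum.cong[OF refl])
    fix y
    have "(\<Sum>h\<in>{h\<in>H. \<phi> h = y}. g (\<phi> h)) = (\<Sum>h\<in>{h\<in>H. \<phi> h = y}. g y)"
      by (rule sum.cong) auto
    thus "(\<Sum>h\<in>{h\<in>H. \<phi> h = y}. g (\<phi> h)) = real (card {h\<in>H. \<phi> h = y}) * g y" by simp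
  qed
  also have "\<dots> \<le> (\<Sum>y\<in>Y. N * g y)"
    using assms by (intro sum_mono mult_right_mono) auto
  finally show ?thesis by (simp add: sum_distrib_left)
qed

lemma sum_Pow_power_card:
  fixes q :: real
  assumes "finite L"
  shows "(\<Sum>S\<in>Pow L. q ^ card S) = (1 + q) ^ card L"
proof -
  have "(1 + q) ^ card L = (\<Prod>x\<in>L. q + 1)" by (simp add: add.commute)
  also have "\<dots> = (\<Sum>S\<in>Pow L. (\<Prod>x\<in>S. q) * (\<Prod>x\<in>L - S. 1))"
    using assms by (rule prod_add)
  finally show ?thesis by simp
qed

text \<open>With both projections injective, \<open>R\<close> is a partial matching, so after AM-GM
  every element of \<open>P\<close> occurs at most once as a left end and at most once as a right
  end.\<close>

lemma sum_pairs_inj_le: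
  fixes w :: "'b \<Rightarrow> real"
  assumes "finite P" "R \<subseteq> P \<times> P" "inj_on fst R" "inj_on snd R"
  shows "(\<Sum>(x, y)\<in>R. w x * w y) \<le> (\<Sum>x\<in>P. (w x)\<^sup>2)"
proof -
  have [simp]: "finite R" using assms finite_subset by blast
  have am_gm: "a * b \<le> (a\<^sup>2 + b\<^sup>2) / 2" for a b :: real
    using sum_squares_bound[of a b] by simp
  have "(\<Sum>(x, y)\<in>R. w x * w y) \<le> (\<Sum>z\<in>R. ((w (fst z))\<^sup>2 + (w (snd z))\<^sup>2) / 2)"
    using am_gm by (intro sum_mono) (simp add: case_prod_beta)
  also have "\<dots> = ((\<Sum>z\<in>R. (w (fst z))\<^sup>2) + (\<Sum>z\<in>R. (w (snd z))\<^sup>2)) / 2"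
    by (simp add: sum.distrib sum_divide_distrib[symmetric])
  also have "(\<Sum>z\<in>R. (w (fst z))\<^sup>2) = (\<Sum>x\<in>fst ` R. (w x)\<^sup>2)"
    using assms by (simp add: sum.reindex)
  also have "\<dots> \<le> (\<Sum>x\<in>P. (w x)\<^sup>2)"
    using assms by (intro sum_mono2) auto
  also have "(\<Sum>z\<in>R. (w (snd z))\<^sup>2) = (\<Sum>x\<in>snd ` R. (w x)\<^sup>2)"
    using assms by (simp add: sum.reindex)
  also have "\<dots> \<le> (\<Sum>x\<in>P. (w x)\<^sup>2)"
    using assms by (intro sum_mono2) auto
  finally show ?thesis by simp
qed

definition words :: "'a set \<Rightarrow> nat \<Rightarrow> 'a list set" where
  "words L p = {l. set l \<subseteq> L \<and> length l = p}"

lemma finite_words [simp]: "finite L \<Longrightarrow> finite (words L p)"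
  unfolding words_def by (rule finite_lists_length_eq)

lemma card_words: "finite L \<Longrightarrow> card (words L p) = card L ^ p"
  unfolding words_def by (rule card_lists_length_eq)

text \<open>Prescribed letter counts fix the multiset of letters, so all these words are
  rearrangements of a single one.\<close>

lemma card_words_same_counts:
  assumes "finite L"
  shows "card {l \<in> words L p. \<forall>x\<in>L. count_list l x = k x} \<le> fact p"
proof (cases "{l \<in> words L p. \<forall>x\<in>L. count_list l x = k x} = {}")
  case False
  then obtain l0 where l0: "l0 \<in> words L p" "\<forall>x\<in>L. count_list l0 x = k x" by auto
  have "{l \<in> words L p. \<forall>x\<in>L. count_list l x = k x} \<subseteq> permutations_of_multiset (mset l0)"
  proof
    fix l assume l: "l \<in> {l \<in> words L p. \<forall>x\<in>L. count_list l x = k x}"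
    have "count_list l x = count_list l0 x" for x
    proof (cases "x \<in> L")
      case False
      hence "x \<notin> set l" "x \<notin> set l0" using l l0 by (auto simp: words_def)
      thus ?thesis by simp
    qed (use l l0 in simp)
    hence "mset l = mset l0"
      by (intro multiset_eqI) (simp add: count_mset)
    thus "l \<in> permutations_of_multiset (mset l0)" by (rule permutations_of_multisetI)
  qed
  hence "card {l \<in> words L p. \<forall>x\<in>L. count_list l x = k x} \<le> card (permutations_of_multiset (mset l0))"
    by (rule card_mono[rotated]) simp
  also have "\<dots> \<le> fact (size (mset l0))"
    by (simp add: card_permutations_of_multiset)
  also have "size (mset l0) = p" using l0 by (simp add: words_def)
  finally show ?thesis .
qed (simp add: fact_ge_1 del: Collect_empty_eq)

section \<open>Products of words and coincidences between them\<close>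

context comm_group begin

definition gprod :: "'a list \<Rightarrow> 'a" where
  "gprod l = foldr (\<otimes>) l \<one>"

lemma gprod_simps [simp]: "gprod [] = \<one>" "gprod (x # l) = x \<otimes> gprod l"
  by (simp_all add: gprod_def)

lemma gprod_closed [simp]: "set l \<subseteq> carrier G \<Longrightarrow> gprod l \<in> carrier G"
  by (induction l) auto

lemma gprod_append:
  "set l \<subseteq> carrier G \<Longrightarrow> set l' \<subseteq> carrier G \<Longrightarrow> gprod (l @ l') = gprod l \<otimes> gprod l'"
  by (induction l) (auto simp: m_assoc)

lemma gprod_eq_finprod:
  assumes "finite L" "L \<subseteq> carrier G" "set l \<subseteq> L"
  shows "gprod l = (\<Otimes>x\<in>L. x [^] count_list l x)"
  using assms(3)
proof (induction l)
  case Nil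
  then show ?case by simp
next
  case (Cons a l)
  have "(\<Otimes>x\<in>L. x [^] count_list (a # l) x)
      = (\<Otimes>x\<in>L. (if a = x then x else \<one>) \<otimes> x [^] count_list l x)"
    using assms by (intro finprod_cong') (auto simp: m_comm subset_iff)
  also have "\<dots> = (\<Otimes>x\<in>L. if a = x then x else \<one>) \<otimes> (\<Otimes>x\<in>L. x [^] count_list l x)"
    using assms by (intro finprod_multf) auto
  also have "(\<Otimes>x\<in>L. if a = x then x else \<one>) = a"
    using assms Cons.prems finprod_singleton[of a L "\<lambda>x. x"] by auto
  finally show ?case using Cons by simp
qed

lemma finprod_subset_indicator:
  assumes "finite L" "L \<subseteq> carrier G" "S \<subseteq> L"
  shows "(\<Otimes>x\<in>L. if x \<in> S then x else \<one>) = (\<Otimes>x\<in>S. x)"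
  using assms by (intro finprod_mono_neutral_cong_right) auto

text \<open>The difference of the indicators of two subsets takes values in -1, 0, 1, so equal
  products yield a relation that dissociativity makes trivial.\<close>

lemma dissociated_subset_products_inj:
  assumes "dissociated G L"
  shows "inj_on (\<lambda>S. \<Otimes>x\<in>S. x) (Pow L)"
proof (rule inj_onI)
  have L: "finite L" "L \<subseteq> carrier G" using assms by (auto simp: dissociated_def)
  fix S S' assume S: "S \<in> Pow L" "S' \<in> Pow L" and eq: "(\<Otimes>x\<in>S. x) = (\<Otimes>x\<in>S'. x)"
  define e :: "'a \<Rightarrow> int" where "e x = of_bool (x \<in> S) - of_bool (x \<in> S')" for x
  have closed: "(\<Otimes>x\<in>L. x [^] e x) \<in> carrier G" "(\<Otimes>x\<in>S'. x) \<in> carrier G"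
    using L S by (auto intro!: finprod_closed)
  \<comment> \<open>Multiplying by the product over \<open>S'\<close> avoids inverting a finite
    product.\<close>
  have "(\<Otimes>x\<in>L. x [^] e x) \<otimes> (\<Otimes>x\<in>S'. x)
      = (\<Otimes>x\<in>L. x [^] e x) \<otimes> (\<Otimes>x\<in>L. if x \<in> S' then x else \<one>)"
    using L S by (simp add: finprod_subset_indicator)
  also have "\<dots> = (\<Otimes>x\<in>L. x [^] e x \<otimes> (if x \<in> S' then x else \<one>))"
    using L by (intro finprod_multf[symmetric]) auto
  also have "\<dots> = (\<Otimes>x\<in>L. if x \<in> S then x else \<one>)"
    using L by (intro finprod_cong') (auto simp: e_def int_pow_neg subset_iff)
  also have "\<dots> = (\<Otimes>x\<in>S'. x)"
    using L S eq by (simp add: finprod_subset_indicator)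
  finally have "(\<Otimes>x\<in>L. x [^] e x) = \<one>"
    using closed r_cancel_one by blast
  moreover have "\<forall>x\<in>L. e x \<in> {-1, 0, 1}" by (auto simp: e_def)
  ultimately have "\<forall>x\<in>L. e x = 0"
    using assms unfolding dissociated_def by blast
  thus "S = S'" using S by (auto simp: e_def of_bool_def split: if_splits)
qed

text \<open>Isolates the part of a word that dissociativity controls: the letters of odd
  multiplicity form a subset product, and the rest consists of even powers.\<close>

lemma gprod_odd_even:
  assumes "finite L" "L \<subseteq> carrier G" "set l \<subseteq> L"
  shows "gprod l = (\<Otimes>x\<in>{x \<in> L. odd (count_list l x)}. x)
                   \<otimes> (\<Otimes>x\<in>L. x [^] (2 * (count_list l x div 2)))"
proof -
  have "gprod l = (\<Otimes>x\<in>L. x [^] count_list l x)" by (rule gprod_eq_finprod[OF assms])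
  also have "\<dots> = (\<Otimes>x\<in>L. (if x \<in> {x \<in> L. odd (count_list l x)} then x else \<one>)
                    \<otimes> x [^] (2 * (count_list l x div 2)))"
  proof (intro finprod_cong')
    fix x assume x: "x \<in> L"
    hence "x \<in> carrier G" using assms by auto
    thus "x [^] count_list l x = (if x \<in> {x \<in> L. odd (count_list l x)} then x else \<one>)
                    \<otimes> x [^] (2 * (count_list l x div 2))"
      using x by (cases "odd (count_list l x)")
        (auto simp: nat_pow_Suc2 elim!: oddE simp flip: nat_pow_Suc2)
  qed (use assms in auto)
  also have "\<dots> = (\<Otimes>x\<in>L. if x \<in> {x \<in> L. odd (count_list l x)} then x else \<one>)
                    \<otimes> (\<Otimes>x\<in>L. x [^] (2 * (count_list l x div 2)))"
    using assms by (intro finprod_multf) auto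
  also have "(\<Otimes>x\<in>L. if x \<in> {x \<in> L. odd (count_list l x)} then x else \<one>)
      = (\<Otimes>x\<in>{x \<in> L. odd (count_list l x)}. x)"
    using assms by (intro finprod_subset_indicator) auto
  finally show ?thesis .
qed

text \<open>The weight \<open>t ^ length l\<close> splits along the same code as the product in
  \<open>gprod_odd_even\<close>, so that the later sum over codes factorises.\<close>

lemma power_length_odd_even:
  fixes t :: real
  assumes "finite L" "set l \<subseteq> L"
  shows "t ^ length l = (\<Prod>x\<in>L. (t\<^sup>2) ^ (count_list l x div 2)) * t ^ card {x \<in> L. odd (count_list l x)}"
proof -
  have "t ^ length l = (\<Prod>x\<in>L. t ^ count_list l x)"
    using sum_count_set[OF assms(2,1)] by (simp add: power_sum[symmetric])
  also have "\<dots> = (\<Prod>x\<in>L. (t\<^sup>2) ^ (count_list l x div 2) * (if odd (count_list l x) then t else 1))"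
  proof (rule prod.cong[OF refl])
    fix x
    show "t ^ count_list l x = (t\<^sup>2) ^ (count_list l x div 2) * (if odd (count_list l x) then t else 1)"
      by (cases "odd (count_list l x)") (auto elim!: oddE evenE simp: power_mult)
  qed
  also have "\<dots> = (\<Prod>x\<in>L. (t\<^sup>2) ^ (count_list l x div 2)) * (\<Prod>x\<in>L. if odd (count_list l x) then t else 1)"
    by (rule prod.distrib)
  also have "(\<Prod>x\<in>L. if odd (count_list l x) then t else 1) = t ^ card {x \<in> L. odd (count_list l x)}"
    using assms by (simp add: prod.If_cases Int_def)
  finally show ?thesis .
qed

text \<open>A word is coded by the set of its letters of odd multiplicity and the halved
  multiplicities. For fixed halved multiplicities of both words the two odd sets determine each
  other, since subset products of a dissociated set are distinct.\<close>

lemma word_pairs_weighted: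
  fixes t :: real
  assumes L: "dissociated G L" and v: "v \<in> carrier G" and t: "0 \<le> t"
  shows "real (card {(l, l') \<in> words L p \<times> words L p. gprod l = v \<otimes> gprod l'}) * t ^ (2 * p)
           \<le> (fact p)\<^sup>2 * ((\<Sum>i\<le>p. (t\<^sup>2) ^ i) ^ (2 * card L) * (1 + t\<^sup>2) ^ card L)"
proof -
  have fL: "finite L" "L \<subseteq> carrier G" using L by (auto simp: dissociated_def)
  define H where "H = {(l, l') \<in> words L p \<times> words L p. gprod l = v \<otimes> gprod l'}"
  \<comment> \<open>\<open>restrict\<close> makes the halved counts extensional, hence elements of
    the finite function space \<open>E\<close>.\<close>
  define J :: "'a list \<Rightarrow> 'a \<Rightarrow> nat" where "J l = restrict (\<lambda>x. count_list l x div 2) L" for l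
  define S where "S l = {x \<in> L. odd (count_list l x)}" for l
  define \<phi> where "\<phi> = (\<lambda>(l, l'). ((J l, J l'), (S l, S l')))"
  define E where "E = (\<Pi>\<^sub>E x\<in>L. {..p})"
  define sq :: "('a \<Rightarrow> nat) \<Rightarrow> 'a" where "sq j = (\<Otimes>x\<in>L. x [^] (2 * j x))" for j
  define R where "R = (\<lambda>(j, j'). {(s, s') \<in> Pow L \<times> Pow L.
                      (\<Otimes>x\<in>s. x) \<otimes> sq j = v \<otimes> ((\<Otimes>x\<in>s'. x) \<otimes> sq j')})"
  define Y where "Y = Sigma (E \<times> E) R"
  define wJ where "wJ j = (\<Prod>x\<in>L. (t\<^sup>2) ^ j x)" for j :: "'a \<Rightarrow> nat"
  define g where "g = (\<lambda>((j, j'), (s, s')). (wJ j * wJ j') * (t ^ card (s :: 'a set) * t ^ card (s' :: 'a set)))"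
  have finE: "finite E" using fL by (auto simp: E_def intro!: finite_PiE)
  have finR: "finite (R z)" for z
    using fL by (cases z) (auto simp: R_def intro: finite_subset[of _ "Pow L \<times> Pow L"])
  have finY: "finite Y" unfolding Y_def using finE finR by auto
  have finH: "finite H"
    unfolding H_def using fL by (auto intro: finite_subset[of _ "words L p \<times> words L p"])
  have wJ0: "wJ j \<ge> 0" for j unfolding wJ_def by (intro prod_nonneg) auto
  have sq_closed: "sq j \<in> carrier G" for j unfolding sq_def using fL by (intro finprod_closed) auto
  have prod_closed: "(\<Otimes>x\<in>s. x) \<in> carrier G" if "s \<subseteq> L" for s
    using fL that by (intro finprod_closed) auto
  have gprod_code: "gprod l = (\<Otimes>x\<in>S l. x) \<otimes> sq (J l)" if "l \<in> words L p" for l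
  proof -
    have "sq (J l) = (\<Otimes>x\<in>L. x [^] (2 * (count_list l x div 2)))"
      unfolding sq_def J_def using fL by (intro finprod_cong') auto
    thus ?thesis using gprod_odd_even[of L l] fL that by (simp add: S_def words_def)
  qed
  have J_in: "J l \<in> E" if "l \<in> words L p" for l
  proof -
    have "count_list l x div 2 \<le> p" for x
      using that count_le_length[of l x] by (auto simp: words_def)
    thus ?thesis by (auto simp: J_def E_def)
  qed
  have "\<phi> ` H \<subseteq> Y"
    using J_in gprod_code by (auto simp: H_def Y_def R_def \<phi>_def S_def)
  have wt: "t ^ p = wJ (J l) * t ^ card (S l)" if "l \<in> words L p" for l
    using power_length_odd_even[of L l t] fL that by (simp add: words_def wJ_def J_def S_def)
  \<comment> \<open>A code fixes all letter counts of both words, so a fibre lies in a product of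
    two classes of rearrangements.\<close>
  have fibre: "card {h \<in> H. \<phi> h = y} \<le> (fact p)\<^sup>2" for y
  proof -
    obtain j j' s s' where y: "y = ((j, j'), (s, s'))" by (metis surj_pair)
    define F where "F = (\<lambda>j s. {l \<in> words L p. \<forall>x\<in>L. count_list l x = 2 * j x + of_bool (x \<in> s)})"
    have F: "l \<in> F (J l) (S l)" if "l \<in> words L p" for l
      using that by (auto simp: F_def J_def S_def)
    have "{h \<in> H. \<phi> h = y} \<subseteq> F j s \<times> F j' s'"
      using F by (auto simp: H_def y \<phi>_def)
    moreover have "finite (F j s \<times> F j' s')" using fL by (auto simp: F_def)
    ultimately have "card {h \<in> H. \<phi> h = y} \<le> card (F j s \<times> F j' s')" by (rule card_mono[rotated])
    also have "\<dots> = card (F j s) * card (F j' s')" by (rule card_cartesian_product)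
    also have "\<dots> \<le> fact p * fact p"
      unfolding F_def using fL by (intro mult_mono card_words_same_counts) auto
    finally show ?thesis by (simp add: power2_eq_square)
  qed
  \<comment> \<open>Every pair in \<open>H\<close> has the same weight \<open>t ^ (2 * p)\<close>,
    so counting \<open>H\<close> becomes summing the weights \<open>g\<close> of codes.\<close>
  have "real (card H) * t ^ (2 * p) = (\<Sum>h\<in>H. g (\<phi> h))"
  proof -
    have "g (\<phi> h) = t ^ (2 * p)" if "h \<in> H" for h
    proof -
      obtain l l' where h: "h = (l, l')" by (cases h)
      have "t ^ (2 * p) = t ^ p * t ^ p" by (simp add: mult_2 power_add)
      also have "\<dots> = (wJ (J l) * t ^ card (S l)) * (wJ (J l') * t ^ card (S l'))"
        using that wt[of l] wt[of l'] by (auto simp: H_def h)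
      finally show ?thesis by (simp add: g_def \<phi>_def h)
    qed
    thus ?thesis by simp
  qed
  also have "\<dots> \<le> (fact p)\<^sup>2 * (\<Sum>y\<in>Y. g y)"
  proof (rule sum_le_fibres[OF finH finY \<open>\<phi> ` H \<subseteq> Y\<close>])
    fix y assume "y \<in> Y"
    show "g y \<ge> 0" using wJ0 t by (auto simp: g_def split: prod.splits)
    have "real (card {h \<in> H. \<phi> h = y}) \<le> real ((fact p)\<^sup>2)"
      using fibre by (simp only: of_nat_le_iff)
    thus "real (card {h \<in> H. \<phi> h = y}) \<le> (fact p)\<^sup>2" by simp
  qed
  also have "(\<Sum>y\<in>Y. g y) = (\<Sum>(j, j')\<in>E \<times> E. \<Sum>(s, s')\<in>R (j, j'). g ((j, j'), (s, s')))"
  proof -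
    have "(\<Sum>y\<in>Y. g y) = (\<Sum>z\<in>E \<times> E. \<Sum>w\<in>R z. g (z, w))"
      unfolding Y_def using finE finR by (subst sum.Sigma) auto
    thus ?thesis by (simp add: case_prod_unfold)
  qed
  also have "\<dots> \<le> (\<Sum>(j, j')\<in>E \<times> E. wJ j * wJ j' * (1 + t\<^sup>2) ^ card L)"
  proof (rule sum_mono, clarify)
    fix j j' assume "j \<in> E" "j' \<in> E"
    have inj: "s1 = s2" if "(\<Otimes>x\<in>s1. x) = (\<Otimes>x\<in>s2. x)" "s1 \<subseteq> L" "s2 \<subseteq> L" for s1 s2
      using dissociated_subset_products_inj[OF L] that by (auto dest: inj_onD)
    have R: "(\<Otimes>x\<in>s. x) \<otimes> sq j = v \<otimes> ((\<Otimes>x\<in>s'. x) \<otimes> sq j')" "s \<subseteq> L" "s' \<subseteq> L"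
      if "(s, s') \<in> R (j, j')" for s s' using that by (auto simp: R_def)
    have "s1 = s2" if "(s, s1) \<in> R (j, j')" "(s, s2) \<in> R (j, j')" for s s1 s2
    proof -
      have "v \<otimes> ((\<Otimes>x\<in>s1. x) \<otimes> sq j') = v \<otimes> ((\<Otimes>x\<in>s2. x) \<otimes> sq j')"
        using R(1)[OF that(1)] R(1)[OF that(2)] by simp
      thus ?thesis using v sq_closed prod_closed R(2,3)[OF that(1)] R(2,3)[OF that(2)]
        by (intro inj) simp_all
    qed
    hence i1: "inj_on fst (R (j, j'))" by (intro inj_onI) (metis prod.collapse)
    have "s1 = s2" if "(s1, s) \<in> R (j, j')" "(s2, s) \<in> R (j, j')" for s s1 s2
    proof -
      have "(\<Otimes>x\<in>s1. x) \<otimes> sq j = (\<Otimes>x\<in>s2. x) \<otimes> sq j"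
        using R(1)[OF that(1)] R(1)[OF that(2)] by simp
      thus ?thesis using v sq_closed prod_closed R(2,3)[OF that(1)] R(2,3)[OF that(2)]
        by (intro inj) simp_all
    qed
    hence i2: "inj_on snd (R (j, j'))" by (intro inj_onI) (metis prod.collapse)
    have "(\<Sum>(s, s')\<in>R (j, j'). g ((j, j'), (s, s')))
        = wJ j * wJ j' * (\<Sum>(s, s')\<in>R (j, j'). t ^ card s * t ^ card s')"
      by (simp add: g_def sum_distrib_left case_prod_beta)
    also have "\<dots> \<le> wJ j * wJ j' * (\<Sum>s\<in>Pow L. (t ^ card s)\<^sup>2)"
      using wJ0 i1 i2 fL by (intro mult_left_mono sum_pairs_inj_le) (auto simp: R_def)
    also have "(\<Sum>s\<in>Pow L. (t ^ card s)\<^sup>2) = (1 + t\<^sup>2) ^ card L"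
      using sum_Pow_power_card[of L "t\<^sup>2"] fL by (simp add: power_mult[symmetric] mult.commute)
    finally show "(\<Sum>(s, s')\<in>R (j, j'). g ((j, j'), (s, s'))) \<le> wJ j * wJ j' * (1 + t\<^sup>2) ^ card L" .
  qed
  also have "\<dots> = (\<Sum>j\<in>E. \<Sum>j'\<in>E. wJ j * wJ j') * (1 + t\<^sup>2) ^ card L"
    by (simp only: sum_Times prod.case sum_distrib_right)
  also have "(\<Sum>j\<in>E. \<Sum>j'\<in>E. wJ j * wJ j') = (\<Sum>j\<in>E. wJ j)\<^sup>2"
    by (simp only: sum_product power2_eq_square)
  \<comment> \<open>The weight is a product over letters, so the sum over \<open>E\<close> is a
    power of a truncated geometric series.\<close>
  also have "(\<Sum>j\<in>E. wJ j) = (\<Sum>i\<le>p. (t\<^sup>2) ^ i) ^ card L"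
    unfolding E_def wJ_def using prod_sum_PiE[of L "\<lambda>_. {..p}" "\<lambda>_ i. (t\<^sup>2) ^ i"] fL by simp
  finally show ?thesis
    by (simp add: H_def power_mult[symmetric] mult.commute)
qed

text \<open>Rankin's trick: the weighted bound is divided by \<open>t ^ (2 * p)\<close>, with
  \<open>t\<^sup>2 = p / card L\<close>. If \<open>card L < 2 * p\<close>, this \<open>t\<close> is
  too large for the geometric series, and counting all pairs of words is enough.\<close>

lemma word_pairs_card_le:
  assumes L: "dissociated G L" and v: "v \<in> carrier G" and p: "p > 0"
  shows "real (card {(l, l') \<in> words L p \<times> words L p. gprod l = v \<otimes> gprod l'})
           \<le> (exp 5 * real p * real (card L)) ^ p" (is "real (card ?H) \<le> _")
proof -
  define d where "d = card L"
  have fL: "finite L" using L by (auto simp: dissociated_def)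
  show ?thesis
  proof (cases "d < 2 * p")
    case True
    have "card ?H \<le> card (words L p \<times> words L p)"
      using fL by (intro card_mono) auto
    also have "\<dots> = d ^ p * d ^ p" using fL by (simp add: card_words d_def)
    also have "\<dots> \<le> (2 * p) ^ p * d ^ p" using True by (intro mult_mono power_mono) auto
    finally have "real (card ?H) \<le> real ((2 * p * d) ^ p)"
      by (simp only: of_nat_le_iff power_mult_distrib)
    also have "\<dots> = (2 * real p * real d) ^ p" by simp
    also have "\<dots> \<le> (exp 5 * real p * real d) ^ p"
      using exp_ge_add_one_self[of 5] by (intro power_mono mult_right_mono) auto
    finally show ?thesis by (simp add: d_def)
  next
    case False
    define q where "q = real p / real d"
    have q: "0 < q" "q \<le> 1 / 2" and qd: "q * real d = real p"
      using False p by (auto simp: q_def field_simps)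
    have "(\<Sum>i\<le>p. q ^ i) \<le> 1 / (1 - q)"
      using q by (simp add: sum_gp0 divide_right_mono)
    also have "\<dots> \<le> 1 + 2 * q"
      using q mult_left_mono[of q "1 / 2" q] by (simp add: field_simps)
    also have "\<dots> \<le> exp (2 * q)" by (rule exp_ge_add_one_self)
    finally have geo: "(\<Sum>i\<le>p. q ^ i) \<le> exp (2 * q)" .
    have "real (card ?H) * q ^ p \<le> (fact p)\<^sup>2 * ((\<Sum>i\<le>p. q ^ i) ^ (2 * d) * (1 + q) ^ d)"
      using word_pairs_weighted[OF L v, of "sqrt q" p] q by (simp add: power_mult d_def)
    also have "\<dots> \<le> (fact p)\<^sup>2 * (exp (2 * q) ^ (2 * d) * exp q ^ d)"
      using q geo exp_ge_add_one_self[of q]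
      by (intro mult_left_mono mult_mono power_mono) (auto intro: sum_nonneg)
    \<comment> \<open>The constant 5 is 4 from the geometric series of the two words plus 1 from the
      factor \<open>1 + q\<close>.\<close>
    also have "exp (2 * q) ^ (2 * d) * exp q ^ d = exp (5 * (q * real d))"
      by (simp add: exp_of_nat_mult[symmetric] exp_add[symmetric] algebra_simps)
    also have "\<dots> = exp 5 ^ p"
      by (simp add: qd exp_of_nat_mult[symmetric] mult.commute)
    also have "(fact p)\<^sup>2 * exp 5 ^ p \<le> (real p ^ p)\<^sup>2 * exp 5 ^ p"
    proof (intro mult_right_mono power_mono)
      show "fact p \<le> real p ^ p" using fact_le_power[of p, where 'a = real] by (simp only: of_nat_power)
    qed auto
    also have "\<dots> = (real p * (q * real d) * exp 5) ^ p"
      by (simp only: qd power2_eq_square power_mult_distrib)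
    also have "\<dots> = (exp 5 * real p * real d) ^ p * q ^ p"
      by (simp only: power_mult_distrib[symmetric] mult_ac)
    finally show ?thesis using q by (simp add: d_def)
  qed
qed

end

section \<open>Convolution with dissociated sets\<close>

lemma sum_mult_power2_le:
  fixes f g :: "'b \<Rightarrow> real"
  shows "(\<Sum>i\<in>A. f i * g i)\<^sup>2 \<le> (\<Sum>i\<in>A. (f i)\<^sup>2) * (\<Sum>i\<in>A. (g i)\<^sup>2)"
proof -
  have "\<bar>\<Sum>i\<in>A. f i * g i\<bar> \<le> (\<Sum>i\<in>A. \<bar>f i\<bar> * \<bar>g i\<bar>)"
    using sum_abs[of "\<lambda>i. f i * g i" A] by (simp add: abs_mult)
  also have "\<dots> \<le> L2_set f A * L2_set g A" by (rule L2_set_mult_ineq)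
  finally have "(\<Sum>i\<in>A. f i * g i)\<^sup>2 \<le> (L2_set f A * L2_set g A)\<^sup>2"
    by (rule power2_le_iff_abs_le[THEN iffD2, rotated]) simp
  thus ?thesis by (simp add: L2_set_def power_mult_distrib sum_nonneg)
qed

lemma sum_words_append:
  fixes h :: "'a list \<Rightarrow> real"
  shows "(\<Sum>l\<in>words L (k + k). h l) = (\<Sum>l\<in>words L k. \<Sum>l'\<in>words L k. h (l @ l'))"
proof -
  have "(\<Sum>l\<in>words L (k + k). h l) = (\<Sum>z\<in>words L k \<times> words L k. h (fst z @ snd z))"
    by (rule sum.reindex_bij_witness[where i = "\<lambda>z. fst z @ snd z" and j = "\<lambda>l. (take k l, drop k l)"])
      (auto simp: words_def dest: in_set_takeD in_set_dropD)
  thus ?thesis by (simp add: sum.cartesian_product case_prod_unfold)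
qed

context comm_group begin

text \<open>\<open>F\<close> is meant as a finite set supporting \<open>f\<close>; the sum then
  stands for a sum over the whole group.\<close>

definition autocorr :: "('a \<Rightarrow> real) \<Rightarrow> 'a set \<Rightarrow> 'a \<Rightarrow> real" where
  "autocorr f F d = (\<Sum>x\<in>F. f x * f (x \<otimes> d))"

text \<open>Substitute \<open>x = z \<otimes> u\<close>. The finite window \<open>Z\<close> replaces
  the group, and the last hypothesis makes it contain every \<open>z\<close> of the carrier with
  \<open>z \<otimes> u \<in> F\<close>.\<close>

lemma sum_translates_eq_autocorr:
  assumes "finite Z" "Z \<subseteq> carrier G" "F \<subseteq> carrier G" "\<And>x. x \<notin> F \<Longrightarrow> f x = 0"
    and "u \<in> carrier G" "v \<in> carrier G" "\<And>x. x \<in> F \<Longrightarrow> x \<otimes> inv u \<in> Z"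
  shows "(\<Sum>z\<in>Z. f (z \<otimes> u) * f (z \<otimes> v)) = autocorr f F (inv u \<otimes> v)"
proof -
  have "(\<Sum>z\<in>Z. f (z \<otimes> u) * f (z \<otimes> v)) = (\<Sum>z\<in>{z\<in>Z. z \<otimes> u \<in> F}. f (z \<otimes> u) * f (z \<otimes> v))"
    using assms by (intro sum.mono_neutral_right) auto
  also have "\<dots> = (\<Sum>x\<in>F. f x * f (x \<otimes> (inv u \<otimes> v)))"
  proof (rule sum.reindex_bij_witness[where i = "\<lambda>x. x \<otimes> inv u" and j = "\<lambda>z. z \<otimes> u"])
    fix z assume "z \<in> {z\<in>Z. z \<otimes> u \<in> F}"
    hence z: "z \<in> carrier G" "z \<otimes> u \<in> F" using assms by auto
    show "z \<otimes> u \<otimes> inv u = z" using z assms by (simp add: m_assoc)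
    show "z \<otimes> u \<in> F" by fact
    have "z \<otimes> u \<otimes> (inv u \<otimes> v) = z \<otimes> v"
      using z assms by (simp add: m_assoc[symmetric]) (simp add: m_assoc)
    thus "f (z \<otimes> u) * f (z \<otimes> u \<otimes> (inv u \<otimes> v)) = f (z \<otimes> u) * f (z \<otimes> v)" by simp
  next
    fix x assume "x \<in> F"
    thus "x \<otimes> inv u \<otimes> u = x" "x \<otimes> inv u \<in> {z \<in> Z. z \<otimes> u \<in> F}"
      using assms by (auto simp: m_assoc subset_iff)
  qed
  finally show ?thesis by (simp add: autocorr_def)
qed

lemma sum_translates_power2:
  assumes "finite Z" "Z \<subseteq> carrier G" "F \<subseteq> carrier G" "\<And>x. x \<notin> F \<Longrightarrow> f x = 0"
    and "\<And>i. i \<in> I \<Longrightarrow> w i \<in> carrier G" "\<And>x i. x \<in> F \<Longrightarrow> i \<in> I \<Longrightarrow> x \<otimes> inv (w i) \<in> Z"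
  shows "(\<Sum>z\<in>Z. (\<Sum>i\<in>I. f (z \<otimes> w i))\<^sup>2) = (\<Sum>i\<in>I. \<Sum>j\<in>I. autocorr f F (inv (w i) \<otimes> w j))"
proof -
  have "(\<Sum>z\<in>Z. (\<Sum>i\<in>I. f (z \<otimes> w i))\<^sup>2) = (\<Sum>z\<in>Z. \<Sum>i\<in>I. \<Sum>j\<in>I. f (z \<otimes> w i) * f (z \<otimes> w j))"
    by (simp add: power2_eq_square sum_product)
  also have "\<dots> = (\<Sum>i\<in>I. \<Sum>z\<in>Z. \<Sum>j\<in>I. f (z \<otimes> w i) * f (z \<otimes> w j))"
    by (rule sum.swap)
  also have "\<dots> = (\<Sum>i\<in>I. \<Sum>j\<in>I. \<Sum>z\<in>Z. f (z \<otimes> w i) * f (z \<otimes> w j))"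
    by (intro sum.cong refl sum.swap)
  also have "\<dots> = (\<Sum>i\<in>I. \<Sum>j\<in>I. autocorr f F (inv (w i) \<otimes> w j))"
    using assms by (intro sum.cong refl sum_translates_eq_autocorr) auto
  finally show ?thesis .
qed

text \<open>With \<open>T f = (\<Sum>i. f (\<cdot> \<otimes> w i))\<close> this says \<open>|T f|\<^sup>4 \<le> |f|\<^sup>2 |T\<^sup>2 f|\<^sup>2\<close>, where
  \<open>T\<close> is normal because the group is commutative.\<close>

lemma autocorr_doubling:
  assumes "finite F" "F \<subseteq> carrier G" "\<And>x. x \<notin> F \<Longrightarrow> f x = 0"
    and "finite I" "\<And>i. i \<in> I \<Longrightarrow> w i \<in> carrier G"
  shows "(\<Sum>i\<in>I. \<Sum>j\<in>I. autocorr f F (inv (w i) \<otimes> w j))\<^sup>2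
       \<le> (\<Sum>x\<in>F. (f x)\<^sup>2) * (\<Sum>j\<in>I. \<Sum>k\<in>I. \<Sum>i\<in>I. \<Sum>l\<in>I.
            autocorr f F (inv (w j \<otimes> w k) \<otimes> (w i \<otimes> w l)))"
proof -
  \<comment> \<open>\<open>u\<close> lists the translations in the product of \<open>T\<close> with
    its adjoint, and \<open>H\<close> is that operator applied to \<open>f\<close>; so
    \<open>|T f|\<^sup>2\<close> is the inner product of \<open>f\<close> and
    \<open>H\<close>.\<close>
  define u where "u = (\<lambda>(i, j). inv (w i) \<otimes> w j)"
  define H where "H x = (\<Sum>a\<in>I \<times> I. f (x \<otimes> u a))" for x
  define Z where "Z = F \<union> (\<lambda>(x, a). x \<otimes> inv (u a)) ` (F \<times> (I \<times> I))"
  have u: "u a \<in> carrier G" if "a \<in> I \<times> I" for a using that assms by (auto simp: u_def)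
  have Z: "finite Z" "Z \<subseteq> carrier G" "F \<subseteq> Z" using assms u by (auto simp: Z_def)
  have "(\<Sum>i\<in>I. \<Sum>j\<in>I. autocorr f F (inv (w i) \<otimes> w j)) = (\<Sum>a\<in>I \<times> I. \<Sum>x\<in>F. f x * f (x \<otimes> u a))"
    by (simp only: sum_Times autocorr_def u_def prod.case)
  also have "\<dots> = (\<Sum>x\<in>F. f x * H x)"
    unfolding H_def sum_distrib_left by (rule sum.swap)
  finally have "(\<Sum>i\<in>I. \<Sum>j\<in>I. autocorr f F (inv (w i) \<otimes> w j))\<^sup>2 \<le> (\<Sum>x\<in>F. (f x)\<^sup>2) * (\<Sum>x\<in>F. (H x)\<^sup>2)"
    by (simp add: sum_mult_power2_le)
  also have "\<dots> \<le> (\<Sum>x\<in>F. (f x)\<^sup>2) * (\<Sum>x\<in>Z. (H x)\<^sup>2)"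
    using Z by (intro mult_left_mono sum_mono2) (auto intro: sum_nonneg)
  also have "(\<Sum>x\<in>Z. (H x)\<^sup>2) = (\<Sum>a\<in>I \<times> I. \<Sum>b\<in>I \<times> I. autocorr f F (inv (u a) \<otimes> u b))"
    unfolding H_def
  proof (rule sum_translates_power2)
    fix x a assume "x \<in> F" "a \<in> I \<times> I"
    thus "x \<otimes> inv (u a) \<in> Z" by (auto simp: Z_def intro!: rev_image_eqI[of "(x, a)"])
  qed (use Z u assms in auto)
  also have "\<dots> = (\<Sum>i\<in>I. \<Sum>j\<in>I. \<Sum>k\<in>I. \<Sum>l\<in>I. autocorr f F (inv (u (i, j)) \<otimes> u (k, l)))"
    by (simp only: sum_Times)
  also have "\<dots> = (\<Sum>i\<in>I. \<Sum>j\<in>I. \<Sum>k\<in>I. \<Sum>l\<in>I. autocorr f F (inv (w j \<otimes> w k) \<otimes> (w i \<otimes> w l)))"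
  proof (intro sum.cong refl)
    fix i j k l assume "i \<in> I" "j \<in> I" "k \<in> I" "l \<in> I"
    hence c: "w i \<in> carrier G" "w j \<in> carrier G" "w k \<in> carrier G" "w l \<in> carrier G" using assms by auto
    \<comment> \<open>Commutativity enters here: the difference of two such translations is
      regrouped as a difference of two products of \<open>w\<close>, which is the normality of
      \<open>T\<close>.\<close>
    have "inv (u (i, j)) \<otimes> u (k, l) = inv (w j \<otimes> w k) \<otimes> (w i \<otimes> w l)"
      using c by (simp add: u_def inv_mult m_ac)
    thus "autocorr f F (inv (u (i, j)) \<otimes> u (k, l)) = autocorr f F (inv (w j \<otimes> w k) \<otimes> (w i \<otimes> w l))"
      by simp
  qed
  also have "\<dots> = (\<Sum>j\<in>I. \<Sum>i\<in>I. \<Sum>k\<in>I. \<Sum>l\<in>I. autocorr f F (inv (w j \<otimes> w k) \<otimes> (w i \<otimes> w l)))"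
    by (rule sum.swap)
  also have "\<dots> = (\<Sum>j\<in>I. \<Sum>k\<in>I. \<Sum>i\<in>I. \<Sum>l\<in>I. autocorr f F (inv (w j \<otimes> w k) \<otimes> (w i \<otimes> w l)))"
    by (intro sum.cong refl sum.swap)
  finally show ?thesis .
qed

text \<open>With \<open>T f = (\<Sum>a\<in>L. f (\<cdot> \<otimes> a))\<close> and \<open>f\<close>
  supported in \<open>F\<close>, this is \<open>|T ^ k f|\<^sup>2\<close>: words of length
  \<open>k\<close> index the translations in \<open>T ^ k\<close>.\<close>

definition word_moment :: "('a \<Rightarrow> real) \<Rightarrow> 'a set \<Rightarrow> 'a set \<Rightarrow> nat \<Rightarrow> real" where
  "word_moment f F L k =
     (\<Sum>l\<in>words L k. \<Sum>l'\<in>words L k. autocorr f F (inv (gprod l) \<otimes> gprod l'))"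

lemma word_moment_doubling:
  assumes "finite F" "F \<subseteq> carrier G" "\<And>x. x \<notin> F \<Longrightarrow> f x = 0" "finite L" "L \<subseteq> carrier G"
  shows "(word_moment f F L k)\<^sup>2 \<le> (\<Sum>x\<in>F. (f x)\<^sup>2) * word_moment f F L (2 * k)"
proof -
  have c: "set l \<subseteq> carrier G" if "l \<in> words L k" for l using that assms by (auto simp: words_def)
  have "word_moment f F L (2 * k) = (\<Sum>j\<in>words L k. \<Sum>k'\<in>words L k. \<Sum>i\<in>words L k. \<Sum>l\<in>words L k.
            autocorr f F (inv (gprod (j @ k')) \<otimes> gprod (i @ l)))"
    by (simp add: word_moment_def mult_2 sum_words_append)
  also have "\<dots> = (\<Sum>j\<in>words L k. \<Sum>k'\<in>words L k. \<Sum>i\<in>words L k. \<Sum>l\<in>words L k.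
            autocorr f F (inv (gprod j \<otimes> gprod k') \<otimes> (gprod i \<otimes> gprod l)))"
    using c by (intro sum.cong refl) (simp add: gprod_append)
  finally show ?thesis
    unfolding word_moment_def[of f F L k]
    using autocorr_doubling[where f = f and I = "words L k" and w = gprod, OF assms(1-3)] assms(4) c by simp
qed

text \<open>Doubling is iterated along powers of two. With \<open>p = 2 ^ j\<close> this is
  \<open>(|T f|\<^sup>2 / |f|\<^sup>2) ^ p \<le> |T ^ p f|\<^sup>2 / |f|\<^sup>2\<close>, cleared of
  denominators.\<close>

lemma word_moment_power:
  assumes "finite F" "F \<subseteq> carrier G" "\<And>x. x \<notin> F \<Longrightarrow> f x = 0" "finite L" "L \<subseteq> carrier G"
    and "\<And>x. f x \<ge> 0" and pos: "(\<Sum>x\<in>F. (f x)\<^sup>2) > 0"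
  shows "word_moment f F L 1 ^ (2 ^ j) * (\<Sum>x\<in>F. (f x)\<^sup>2)
       \<le> (\<Sum>x\<in>F. (f x)\<^sup>2) ^ (2 ^ j) * word_moment f F L (2 ^ j)"
proof (induction j)
  case (Suc j)
  let ?N = "\<Sum>x\<in>F. (f x)\<^sup>2" and ?q = "2 ^ j :: nat"
  have nonneg: "word_moment f F L k \<ge> 0" for k
    using assms(6) by (auto simp: word_moment_def autocorr_def intro!: sum_nonneg)
  have "(word_moment f F L 1 ^ ?q * ?N)\<^sup>2 \<le> (?N ^ ?q * word_moment f F L ?q)\<^sup>2"
    using Suc nonneg pos by (intro power_mono) auto
  also have "\<dots> \<le> (?N ^ ?q)\<^sup>2 * (?N * word_moment f F L (2 * ?q))"
    using word_moment_doubling[where f = f and k = ?q, OF assms(1-5)] by (simp add: power_mult_distrib mult_left_mono)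
  finally have "(word_moment f F L 1 ^ (2 ^ Suc j) * ?N) * ?N
      \<le> (?N ^ (2 ^ Suc j) * word_moment f F L (2 ^ Suc j)) * ?N"
    by (simp add: power_mult_distrib power_mult[symmetric] power2_eq_square[of ?N] mult_ac)
  thus ?case using pos by simp
qed (simp add: mult.commute)

text \<open>After expansion the pair \<open>(x, y)\<close> carries \<open>f x * f y\<close> times
  the number of word pairs whose products differ by \<open>y \<otimes> inv x\<close>, which
  \<open>word_pairs_card_le\<close> bounds uniformly.\<close>

lemma word_moment_le:
  assumes F: "finite F" "F \<subseteq> carrier G" "\<And>x. x \<notin> F \<Longrightarrow> f x = 0" "\<And>x. f x \<ge> 0"
    and L: "dissociated G L" and p: "p > 0"
  shows "word_moment f F L p \<le> (exp 5 * real p * real (card L)) ^ p * (\<Sum>x\<in>F. f x)\<^sup>2"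
proof -
  have fL: "finite L" "L \<subseteq> carrier G" using L by (auto simp: dissociated_def)
  let ?W = "words L p"
  define H where "H x y = {(l, l') \<in> ?W \<times> ?W. gprod l = (y \<otimes> inv x) \<otimes> gprod l'}" for x y
  have c: "gprod l \<in> carrier G" if "l \<in> ?W" for l using that fL by (intro gprod_closed) (auto simp: words_def)
  have "word_moment f F L p = (\<Sum>l'\<in>?W. \<Sum>l\<in>?W. \<Sum>x\<in>F. f x * f (x \<otimes> (inv (gprod l') \<otimes> gprod l)))"
    by (simp add: word_moment_def autocorr_def)
  also have "\<dots> = (\<Sum>l'\<in>?W. \<Sum>l\<in>?W. \<Sum>x\<in>F. \<Sum>y\<in>F. f x * f y * of_bool ((l, l') \<in> H x y))"
  proof (intro sum.cong refl)
    fix l' l x assume l: "l' \<in> ?W" "l \<in> ?W" and x: "x \<in> F"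
    have cc: "gprod l \<in> carrier G" "gprod l' \<in> carrier G" "x \<in> carrier G" using l c x F by auto
    have iff: "(l, l') \<in> H x y \<longleftrightarrow> x \<otimes> (inv (gprod l') \<otimes> gprod l) = y" if "y \<in> F" for y
    proof -
      have y: "y \<in> carrier G" using that F by auto
      have "(l, l') \<in> H x y \<longleftrightarrow> gprod l = inv x \<otimes> (gprod l' \<otimes> y)"
        using l y cc by (simp add: H_def m_ac)
      also have "\<dots> \<longleftrightarrow> gprod l' \<otimes> y = x \<otimes> gprod l"
        using y cc by (simp add: inv_solve_left)
      also have "\<dots> \<longleftrightarrow> y = inv (gprod l') \<otimes> (x \<otimes> gprod l)"
        using y cc by (simp add: inv_solve_left eq_commute[of "gprod l' \<otimes> y"])
      also have "\<dots> \<longleftrightarrow> x \<otimes> (inv (gprod l') \<otimes> gprod l) = y"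
        using y cc by (auto simp: m_lcomm)
      finally show ?thesis .
    qed
    have "(\<Sum>y\<in>F. f x * f y * of_bool ((l, l') \<in> H x y))
        = (\<Sum>y\<in>F. if x \<otimes> (inv (gprod l') \<otimes> gprod l) = y then f x * f y else 0)"
      by (intro sum.cong refl) (simp add: iff)
    also have "\<dots> = f x * f (x \<otimes> (inv (gprod l') \<otimes> gprod l))"
      using F by simp
    finally show "f x * f (x \<otimes> (inv (gprod l') \<otimes> gprod l)) = (\<Sum>y\<in>F. f x * f y * of_bool ((l, l') \<in> H x y))"
      by simp
  qed
  also have "\<dots> = (\<Sum>z\<in>?W \<times> ?W. \<Sum>x\<in>F. \<Sum>y\<in>F. f x * f y * of_bool (z \<in> H x y))"
    by (subst sum.swap) (simp only: sum_Times)
  also have "\<dots> = (\<Sum>x\<in>F. \<Sum>z\<in>?W \<times> ?W. \<Sum>y\<in>F. f x * f y * of_bool (z \<in> H x y))"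
    by (rule sum.swap)
  also have "\<dots> = (\<Sum>x\<in>F. \<Sum>y\<in>F. \<Sum>z\<in>?W \<times> ?W. f x * f y * of_bool (z \<in> H x y))"
    by (intro sum.cong refl sum.swap)
  also have "\<dots> = (\<Sum>x\<in>F. \<Sum>y\<in>F. f x * f y * real (card (H x y)))"
  proof (intro sum.cong refl)
    fix x y
    have "(\<Sum>z\<in>?W \<times> ?W. of_bool (z \<in> H x y)) = real (card (H x y))"
      using fL by (simp add: Int_absorb1 H_def subset_iff)
    thus "(\<Sum>z\<in>?W \<times> ?W. f x * f y * of_bool (z \<in> H x y)) = f x * f y * real (card (H x y))"
      by (simp add: sum_distrib_left[symmetric])
  qed
  also have "\<dots> \<le> (\<Sum>x\<in>F. \<Sum>y\<in>F. f x * f y * (exp 5 * real p * real (card L)) ^ p)"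
  proof (intro sum_mono mult_left_mono)
    fix x y assume "x \<in> F" "y \<in> F"
    thus "real (card (H x y)) \<le> (exp 5 * real p * real (card L)) ^ p"
      unfolding H_def using F by (intro word_pairs_card_le L p) auto
  qed (use F in auto)
  also have "\<dots> = (exp 5 * real p * real (card L)) ^ p * (\<Sum>x\<in>F. f x)\<^sup>2"
  proof -
    have "(\<Sum>x\<in>F. \<Sum>y\<in>F. f x * f y * K) = K * (\<Sum>x\<in>F. f x)\<^sup>2" for K
    proof -
      have "(\<Sum>x\<in>F. \<Sum>y\<in>F. f x * f y * K) = (\<Sum>x\<in>F. \<Sum>y\<in>F. K * (f x * f y))"
        by (intro sum.cong refl) simp
      thus ?thesis by (simp only: power2_eq_square sum_product) (simp only: sum_distrib_left)
    qed
    thus ?thesis .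
  qed
  finally show ?thesis .
qed

text \<open>The squared norm of \<open>\<lambda>z. \<Sum>a\<in>V. f (z \<otimes> a)\<close> when
  \<open>f\<close> is supported in \<open>F\<close>, that is, of the convolution of \<open>f\<close>
  with the reflected indicator of \<open>V\<close>.\<close>

definition conv_norm2 :: "('a \<Rightarrow> real) \<Rightarrow> 'a set \<Rightarrow> 'a set \<Rightarrow> real" where
  "conv_norm2 f F V = (\<Sum>a\<in>V. \<Sum>b\<in>V. autocorr f F (inv a \<otimes> b))"

lemma word_moment_1:
  assumes "L \<subseteq> carrier G"
  shows "word_moment f F L 1 = conv_norm2 f F L"
proof -
  have W: "words L 1 = (\<lambda>a. [a]) ` L"
    by (auto simp: words_def length_Suc_conv)
  show ?thesis
    using assms unfolding word_moment_def conv_norm2_def W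
    by (subst sum.reindex, simp add: inj_on_def, subst sum.reindex, simp add: inj_on_def)
      (auto intro!: sum.cong simp: subset_iff)
qed

text \<open>Doubling reaches only exponents that are powers of two, so the logarithm is rounded up
  to one, at the cost of a factor 2.\<close>

lemma exists_power2_log:
  assumes "n \<ge> (2::nat)"
  obtains j where "log 2 n \<le> 2 ^ j" "2 ^ j \<le> 2 * log 2 n"
proof -
  let ?P = "\<lambda>j. log 2 n \<le> 2 ^ j"
  have log: "log 2 n \<ge> 1" using assms by simp
  have ex: "?P n"
    using assms less_exp[of n] by (intro order.trans[OF log_le_cancel_iff[THEN iffD2, of 2 n "2 ^ n"]]) auto
  define j where "j = (LEAST j. ?P j)"
  have j: "?P j" unfolding j_def by (rule LeastI[of ?P, OF ex])
  have "2 ^ j \<le> 2 * log 2 n"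
  proof (cases j)
    case 0
    thus ?thesis using log by simp
  next
    case (Suc i)
    hence "\<not> ?P i" using not_less_Least[of i ?P] by (simp add: j_def)
    thus ?thesis using Suc by simp
  qed
  thus ?thesis using j that by blast
qed

text \<open>Taking \<open>p\<close>-th roots with \<open>p\<close> about \<open>log 2 n\<close>
  turns the Cauchy-Schwarz factor \<open>card F \<le> n\<^sup>2 \<le> 4 ^ p\<close> into the
  constant 4; rounding \<open>p\<close> to a power of two doubles it to 8.\<close>

lemma conv_norm2_dissociated_le:
  assumes F: "finite F" "F \<subseteq> carrier G" "\<And>x. x \<notin> F \<Longrightarrow> f x = 0" "\<And>x. f x \<ge> 0"
    and L: "dissociated G L" and n: "n \<ge> 2" "card F \<le> n\<^sup>2"
  shows "conv_norm2 f F L \<le> 8 * exp 5 * log 2 n * real (card L) * (\<Sum>x\<in>F. (f x)\<^sup>2)"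
proof -
  have fL: "finite L" "L \<subseteq> carrier G" using L by (auto simp: dissociated_def)
  define N where "N = (\<Sum>x\<in>F. (f x)\<^sup>2)"
  have N0: "N \<ge> 0" by (auto simp: N_def intro: sum_nonneg)
  have log: "log 2 n \<ge> 1" using n by simp
  show ?thesis
  proof (cases "N = 0")
    case True
    hence "\<forall>x\<in>F. f x = 0" using F by (simp add: N_def sum_nonneg_eq_0_iff)
    hence "conv_norm2 f F L = 0" by (simp add: conv_norm2_def autocorr_def)
    thus ?thesis using True by (simp add: N_def)
  next
    case False
    hence N: "N > 0" using N0 by simp
    obtain j where j: "log 2 n \<le> 2 ^ j" "2 ^ j \<le> 2 * log 2 n" using exists_power2_log[OF n(1)] .
    define p :: nat where "p = 2 ^ j"
    have p: "p > 0" "log 2 n \<le> real p" "real p \<le> 2 * log 2 n" using j by (auto simp: p_def)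
    have "real n = 2 powr (log 2 n)" using n by simp
    also have "\<dots> \<le> 2 powr (real p)" using p by simp
    finally have np: "real n \<le> 2 ^ p" by (simp add: powr_realpow)
    have "(\<Sum>x\<in>F. f x * 1)\<^sup>2 \<le> N * (\<Sum>x\<in>F. 1\<^sup>2)"
      unfolding N_def by (rule sum_mult_power2_le)
    also have "\<dots> \<le> N * (real n)\<^sup>2"
    proof (rule mult_left_mono)
      show "(\<Sum>x\<in>F. 1\<^sup>2) \<le> (real n)\<^sup>2"
        using n(2) by (simp flip: of_nat_power)
    qed (use N in auto)
    also have "\<dots> \<le> N * 4 ^ p"
    proof (rule mult_left_mono)
      have "(real n)\<^sup>2 \<le> (2 ^ p)\<^sup>2" using np by (intro power_mono) auto
      also have "(2 ^ p)\<^sup>2 = (4 :: real) ^ p" by (simp add: power2_eq_square power_mult_distrib[symmetric])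
      finally show "(real n)\<^sup>2 \<le> 4 ^ p" .
    qed (use N in auto)
    finally have l1: "(\<Sum>x\<in>F. f x)\<^sup>2 \<le> N * 4 ^ p" by simp
    have "conv_norm2 f F L ^ p * N \<le> N ^ p * word_moment f F L p"
      using word_moment_power[where f = f and j = j, OF F(1-3) fL F(4)] N
      by (simp add: p_def N_def word_moment_1[OF fL(2), simplified])
    also have "\<dots> \<le> N ^ p * ((exp 5 * real p * real (card L)) ^ p * (\<Sum>x\<in>F. f x)\<^sup>2)"
      using N by (intro mult_left_mono word_moment_le F L p) auto
    also have "\<dots> \<le> N ^ p * ((exp 5 * real p * real (card L)) ^ p * (N * 4 ^ p))"
      using N l1 by (intro mult_left_mono) auto
    also have "\<dots> = (4 * exp 5 * real p * real (card L) * N) ^ p * N"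
      by (simp add: power_mult_distrib mult_ac)
    finally have "conv_norm2 f F L ^ p \<le> (4 * exp 5 * real p * real (card L) * N) ^ p"
      using N by simp
    hence "conv_norm2 f F L \<le> 4 * exp 5 * real p * real (card L) * N"
      using N p by (rule_tac power_le_imp_le_base[of _ "p - 1"]) auto
    also have "\<dots> \<le> 4 * exp 5 * (2 * log 2 n) * real (card L) * N"
      using p N by (intro mult_right_mono mult_left_mono) auto
    finally show ?thesis by (simp add: N_def)
  qed
qed

text \<open>Peel off dissociated sets of size \<open>D\<close> until fewer than \<open>m\<close> elements remain, and apply
  the triangle inequality to the corresponding parts of the convolution.\<close>

lemma conv_norm2_le:
  assumes F: "finite F" "F \<subseteq> carrier G" "\<And>x. x \<notin> F \<Longrightarrow> f x = 0" "\<And>x. f x \<ge> 0"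
    and n: "n \<ge> 2" "card F \<le> n\<^sup>2"
    and A: "finite A" "A \<subseteq> carrier G"
    and D: "D > 0" and m: "m \<ge> 0"
    and rich: "\<And>B. B \<subseteq> A \<Longrightarrow> m \<le> real (card B) \<Longrightarrow> \<exists>L\<subseteq>B. dissociated G L \<and> card L = D"
    and V: "V \<subseteq> A"
  shows "conv_norm2 f F V
       \<le> (\<Sum>x\<in>F. (f x)\<^sup>2) * (16 * exp 5 * log 2 n / real D * (real (card V))\<^sup>2 + 2 * m\<^sup>2)"
proof -
  define Z where "Z = (\<lambda>(x, a). x \<otimes> inv a) ` (F \<times> A)"
  define N where "N = sqrt (\<Sum>x\<in>F. (f x)\<^sup>2)"
  \<comment> \<open>\<open>N * c * D\<close> bounds the contribution of one dissociated set of size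
    \<open>D\<close>, so peeled sets cost \<open>N * c\<close> per element and their bounds add
    up.\<close>
  define c where "c = sqrt (8 * exp 5 * log 2 n / real D)"
  define q where "q Y = L2_set (\<lambda>z. \<Sum>a\<in>Y. f (z \<otimes> a)) Z" for Y
  have N0: "N \<ge> 0" by (simp add: N_def sum_nonneg)
  have c0: "c \<ge> 0" using n by (simp add: c_def)
  have Z: "finite Z" "Z \<subseteq> carrier G" using F(1,2) A by (auto simp: Z_def subset_iff)
  have q2: "(q Y)\<^sup>2 = conv_norm2 f F Y" if "Y \<subseteq> A" for Y
  proof -
    have "(\<Sum>z\<in>Z. (\<Sum>i\<in>Y. f (z \<otimes> i))\<^sup>2) = (\<Sum>i\<in>Y. \<Sum>j\<in>Y. autocorr f F (inv i \<otimes> j))"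
    proof (rule sum_translates_power2)
      fix x i assume "x \<in> F" "i \<in> Y"
      thus "x \<otimes> inv i \<in> Z" using that by (auto simp: Z_def intro!: rev_image_eqI[of "(x, i)"])
    qed (use Z F A that in auto)
    moreover have "(q Y)\<^sup>2 = (\<Sum>z\<in>Z. (\<Sum>i\<in>Y. f (z \<otimes> i))\<^sup>2)"
      unfolding q_def L2_set_def by (rule real_sqrt_pow2) (simp add: sum_nonneg)
    ultimately show ?thesis by (simp add: conv_norm2_def)
  qed
  have q0: "q Y \<ge> 0" for Y by (simp add: q_def)
  have q_Un: "q (Y \<union> Y') \<le> q Y + q Y'" if "Y \<subseteq> A" "Y' \<subseteq> A" "Y \<inter> Y' = {}" for Y Y'
  proof -
    have "finite Y" "finite Y'" using that A by (auto intro: finite_subset)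
    hence "q (Y \<union> Y') = L2_set (\<lambda>z. (\<Sum>a\<in>Y. f (z \<otimes> a)) + (\<Sum>a\<in>Y'. f (z \<otimes> a))) Z"
      using that by (simp add: q_def sum.union_disjoint)
    thus ?thesis unfolding q_def by (simp add: L2_set_triangle_ineq)
  qed
  \<comment> \<open>Each single translate of \<open>f\<close> has norm \<open>N\<close>; this
    controls the fewer than \<open>m\<close> elements left over.\<close>
  have q_trivial: "q Y \<le> real (card Y) * N" if "Y \<subseteq> A" for Y
  proof -
    have "finite Y" using that A finite_subset by auto
    thus ?thesis using that
    proof (induction Y)
      case empty
      thus ?case by (simp add: q_def L2_set_def)
    next
      case (insert a Y)
      have "a \<in> carrier G" using insert A by auto
      hence "autocorr f F (inv a \<otimes> a) = (\<Sum>x\<in>F. (f x)\<^sup>2)"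
        using F by (auto simp: autocorr_def power2_eq_square intro!: sum.cong)
      hence "(q {a})\<^sup>2 = N\<^sup>2" using q2[of "{a}"] insert by (simp add: conv_norm2_def N_def sum_nonneg)
      hence "q {a} = N" using q0 N0 by (simp add: power2_eq_iff_nonneg)
      thus ?case using q_Un[of "{a}" Y] insert by (simp add: algebra_simps)
    qed
  qed
  have "q Y \<le> N * (c * real (card Y) + m)" if "Y \<subseteq> A" for Y
    using that
  proof (induction "card Y" arbitrary: Y rule: less_induct)
    case less
    have fin: "finite Y" using less.prems A(1) by (rule finite_subset)
    show ?case
    proof (cases "m \<le> real (card Y)")
      case False
      have "q Y \<le> real (card Y) * N" by (rule q_trivial) fact
      also have "\<dots> \<le> N * (c * real (card Y) + m)"
      proof -
        have "0 \<le> c * real (card Y)" using c0 by simp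
        hence "real (card Y) \<le> c * real (card Y) + m" using False by linarith
        thus ?thesis using N0 by (simp add: mult.commute mult_left_mono)
      qed
      finally show ?thesis .
    next
      case True
      then obtain L where L: "L \<subseteq> Y" "dissociated G L" "card L = D" using rich less by blast
      have card: "card (Y - L) = card Y - D" "D \<le> card Y"
        using L fin by (auto simp: card_Diff_subset finite_subset card_mono)
      have "(q L)\<^sup>2 \<le> 8 * exp 5 * log 2 n * real D * N\<^sup>2"
        using q2[of L] L less conv_norm2_dissociated_le[OF F L(2) n] by (auto simp: N_def sum_nonneg)
      also have "\<dots> = (N * (c * real D))\<^sup>2"
        using D n by (simp add: c_def power_mult_distrib power2_eq_square field_simps)
      finally have "q L \<le> N * (c * real D)"
        using N0 c0 by (rule_tac power2_le_imp_le) auto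
      moreover have "q (Y - L) \<le> N * (c * real (card (Y - L)) + m)"
        using less card D by (intro less(1)) auto
      moreover have "q Y \<le> q L + q (Y - L)"
        using q_Un[of L "Y - L"] L less by (auto simp: Un_absorb1)
      ultimately have "q Y \<le> N * (c * real D) + N * (c * real (card (Y - L)) + m)" by linarith
      also have "\<dots> = N * (c * real (card Y) + m)"
        using card by (simp add: algebra_simps of_nat_diff)
      finally show ?thesis .
    qed
  qed
  hence "q V \<le> N * (c * real (card V) + m)" using V by blast
  hence "conv_norm2 f F V \<le> (N * (c * real (card V) + m))\<^sup>2"
    using q2[OF V] q0[of V] power_mono[of "q V" _ 2] by simp
  also have "\<dots> = N\<^sup>2 * (c * real (card V) + m)\<^sup>2" by (simp add: power_mult_distrib)
  \<comment> \<open>Squaring the sum costs a factor 2 on each term, which turns 8 into 16.\<close>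
  also have "\<dots> \<le> N\<^sup>2 * (2 * (c * real (card V))\<^sup>2 + 2 * m\<^sup>2)"
    using sum_squares_bound[of "c * real (card V)" m]
    by (intro mult_left_mono) (auto simp: power2_sum)
  also have "N\<^sup>2 = (\<Sum>x\<in>F. (f x)\<^sup>2)" by (simp add: N_def sum_nonneg)
  also have "2 * (c * real (card V))\<^sup>2 = 16 * exp 5 * log 2 n / real D * (real (card V))\<^sup>2"
    using n by (simp add: c_def power_mult_distrib)
  finally show ?thesis .
qed


section \<open>Representation function and slices\<close>

definition slice :: "'a set \<Rightarrow> 'a \<Rightarrow> 'a set" where
  "slice V d = {b \<in> V. d \<otimes> b \<in> V}"

text \<open>An element \<open>b\<close> of the slice encodes the representation of \<open>d\<close>
  as the difference of \<open>d \<otimes> b\<close> and \<open>b\<close>.\<close>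

definition rep :: "'a set \<Rightarrow> 'a \<Rightarrow> real" where
  "rep V d = real (card (slice V d))"

definition diffset :: "'a set \<Rightarrow> 'a set" where
  "diffset V = (\<lambda>(a, b). a \<otimes> inv b) ` (V \<times> V)"

lemma rep_nonneg [simp]: "rep V d \<ge> 0"
  by (simp add: rep_def)

lemma mult_inv_cancel:
  assumes "b \<in> carrier G" "x \<in> carrier G"
  shows "b \<otimes> (inv b \<otimes> x) = x" "b \<otimes> (x \<otimes> inv b) = x"
proof -
  show "b \<otimes> (inv b \<otimes> x) = x" using assms by (simp add: m_assoc[symmetric])
  thus "b \<otimes> (x \<otimes> inv b) = x" using assms by (simp add: m_comm)
qed

lemma mult_mult_inv_cancel:
  assumes "b \<in> carrier G" "x \<in> carrier G" "y \<in> carrier G"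
  shows "b \<otimes> (x \<otimes> (inv b \<otimes> y)) = x \<otimes> y" "b \<otimes> (x \<otimes> (y \<otimes> inv b)) = x \<otimes> y"
  using mult_inv_cancel[of b "x \<otimes> y"] assms by (simp_all add: m_ac)

lemma diff_eq_iff:
  assumes "a \<in> carrier G" "b \<in> carrier G" "d \<in> carrier G"
  shows "a \<otimes> inv b = d \<longleftrightarrow> a = d \<otimes> b"
  using assms by (metis inv_closed inv_solve_right inv_inv m_assoc r_one l_inv m_closed)

lemma diff_in_diffset: "a \<in> V \<Longrightarrow> b \<in> V \<Longrightarrow> a \<otimes> inv b \<in> diffset V"
  by (force simp: diffset_def)

context
  fixes V :: "'a set"
  assumes fin: "finite V" and sub: "V \<subseteq> carrier G"
begin

lemma carrier_V: "a \<in> V \<Longrightarrow> a \<in> carrier G"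
  using sub by auto

lemma finite_diffset: "finite (diffset V)"
  using fin by (simp add: diffset_def)

lemma diffset_closed: "d \<in> diffset V \<Longrightarrow> d \<in> carrier G"
  using sub by (auto simp: diffset_def)

lemma card_diffset_le: "card (diffset V) \<le> (card V)\<^sup>2"
  unfolding diffset_def using card_image_le[of "V \<times> V"] fin
  by (simp add: card_cartesian_product power2_eq_square)

lemma finite_slice: "finite (slice V d)"
  using fin by (simp add: slice_def)

lemma slice_subset: "slice V d \<subseteq> V"
  by (auto simp: slice_def)

lemma rep_le_card: "rep V d \<le> real (card V)"
  unfolding rep_def using fin slice_subset by (simp add: card_mono)

lemma rep_inv: "d \<in> carrier G \<Longrightarrow> rep V (inv d) = rep V d"
proof -
  assume d: "d \<in> carrier G"
  have "bij_betw (\<lambda>b. d \<otimes> b) (slice V d) (slice V (inv d))"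
    by (rule bij_betw_byWitness[where f' = "\<lambda>b. inv d \<otimes> b"])
      (use d carrier_V in \<open>auto simp: slice_def m_assoc[symmetric]\<close>)
  thus ?thesis by (simp add: rep_def bij_betw_same_card)
qed

lemma rep_diff_commute: "a \<in> carrier G \<Longrightarrow> b \<in> carrier G \<Longrightarrow> rep V (a \<otimes> inv b) = rep V (b \<otimes> inv a)"
  using rep_inv[of "a \<otimes> inv b"] by (simp add: inv_mult m_comm)

lemma sum_diff_left:
  assumes b: "b \<in> V"
  shows "(\<Sum>a\<in>V. g (a \<otimes> inv b)) = (\<Sum>x\<in>{x \<in> diffset V. b \<in> slice V x}. g x)"
  by (rule sum.reindex_bij_witness[where i = "\<lambda>x. x \<otimes> b" and j = "\<lambda>a. a \<otimes> inv b"])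
    (use b carrier_V diffset_closed in \<open>auto simp: m_assoc slice_def diff_in_diffset\<close>)

text \<open>With \<open>u = x \<otimes> b\<close>, the element \<open>x \<otimes> b'\<close> is the
  translate of \<open>u\<close> by \<open>b' \<otimes> inv b\<close>; both lie in \<open>V\<close>
  exactly when \<open>u\<close> is in that slice. The double counts below rest on this.\<close>

lemma sum_common_slice:
  assumes b: "b \<in> V" and b': "b' \<in> V"
  shows "(\<Sum>x\<in>{x \<in> diffset V. b \<in> slice V x \<and> b' \<in> slice V x}. g (x \<otimes> b))
       = (\<Sum>u\<in>slice V (b' \<otimes> inv b). g u)"
proof (rule sum.reindex_bij_witness[where i = "\<lambda>u. u \<otimes> inv b" and j = "\<lambda>x. x \<otimes> b"])
  fix x assume "x \<in> {x \<in> diffset V. b \<in> slice V x \<and> b' \<in> slice V x}"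
  hence x: "x \<in> carrier G" "x \<otimes> b \<in> V" "x \<otimes> b' \<in> V" using diffset_closed by (auto simp: slice_def)
  show "x \<otimes> b \<otimes> inv b = x" using x b carrier_V by (simp add: m_assoc)
  have "b' \<otimes> inv b \<otimes> (x \<otimes> b) = x \<otimes> b'"
    using x carrier_V[OF b] carrier_V[OF b'] by (simp add: m_ac mult_inv_cancel mult_mult_inv_cancel)
  thus "x \<otimes> b \<in> slice V (b' \<otimes> inv b)" using x by (simp add: slice_def)
next
  fix u assume "u \<in> slice V (b' \<otimes> inv b)"
  hence u: "u \<in> V" "b' \<otimes> inv b \<otimes> u \<in> V" by (auto simp: slice_def)
  note c = carrier_V[OF u(1)] carrier_V[OF b] carrier_V[OF b']
  show "u \<otimes> inv b \<otimes> b = u" using c by (simp add: m_assoc)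
  have "u \<otimes> inv b \<otimes> b' = b' \<otimes> inv b \<otimes> u" using c by (simp add: m_ac)
  thus "u \<otimes> inv b \<in> {x \<in> diffset V. b \<in> slice V x \<and> b' \<in> slice V x}"
    using u b b' c by (simp add: slice_def diff_in_diffset m_assoc)
qed simp

lemma card_common_slice:
  assumes b: "b \<in> V" and b': "b' \<in> V"
  shows "real (card {x \<in> diffset V. b \<in> slice V x \<and> b' \<in> slice V x}) = rep V (b \<otimes> inv b')"
  using sum_common_slice[OF assms, of "\<lambda>_. 1 :: real"] rep_diff_commute[of b b'] carrier_V b b'
  by (simp add: rep_def)

lemma sum_diffset_rep:
  fixes g :: "'a \<Rightarrow> real"
  shows "(\<Sum>d\<in>diffset V. rep V d * g d) = (\<Sum>b\<in>V. \<Sum>a\<in>V. g (a \<otimes> inv b))"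
proof -
  have "(\<Sum>b\<in>V. \<Sum>a\<in>V. g (a \<otimes> inv b)) = (\<Sum>b\<in>V. \<Sum>x\<in>{x \<in> diffset V. b \<in> slice V x}. g x)"
    by (intro sum.cong refl sum_diff_left)
  also have "\<dots> = (\<Sum>x\<in>diffset V. \<Sum>b\<in>{b \<in> V. b \<in> slice V x}. g x)"
    by (rule sum.swap_restrict[OF fin finite_diffset])
  also have "\<dots> = (\<Sum>x\<in>diffset V. rep V x * g x)"
    by (intro sum.cong refl) (auto simp: rep_def slice_def)
  finally show ?thesis by simp
qed

lemma sum_rep: "(\<Sum>d\<in>diffset V. rep V d) = (real (card V))\<^sup>2"
  using sum_diffset_rep[of "\<lambda>_. 1"] by (simp add: power2_eq_square)

text \<open>\<open>rep V\<close> is positive semidefinite: \<open>rep V (a \<otimes> inv c)\<close> counts the \<open>z\<close> whose slice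
  contains both \<open>a\<close> and \<open>c\<close>.\<close>

lemma rep_form_eq:
  fixes u v :: "'a \<Rightarrow> real"
  shows "(\<Sum>a\<in>V. \<Sum>c\<in>V. u a * v c * rep V (a \<otimes> inv c))
       = (\<Sum>z\<in>diffset V. (\<Sum>a\<in>slice V z. u a) * (\<Sum>c\<in>slice V z. v c))"
proof -
  have "(\<Sum>z\<in>diffset V. (\<Sum>a\<in>slice V z. u a) * (\<Sum>c\<in>slice V z. v c))
      = (\<Sum>z\<in>diffset V. \<Sum>p\<in>{p \<in> V \<times> V. fst p \<in> slice V z \<and> snd p \<in> slice V z}. u (fst p) * v (snd p))"
  proof (rule sum.cong[OF refl])
    fix z
    have "{p \<in> V \<times> V. fst p \<in> slice V z \<and> snd p \<in> slice V z} = slice V z \<times> slice V z"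
      by (auto simp: slice_def)
    thus "(\<Sum>a\<in>slice V z. u a) * (\<Sum>c\<in>slice V z. v c)
        = (\<Sum>p\<in>{p \<in> V \<times> V. fst p \<in> slice V z \<and> snd p \<in> slice V z}. u (fst p) * v (snd p))"
      by (simp only: sum_product sum_Times fst_conv snd_conv)
  qed
  also have "\<dots> = (\<Sum>p\<in>V \<times> V. \<Sum>z\<in>{z \<in> diffset V. fst p \<in> slice V z \<and> snd p \<in> slice V z}. u (fst p) * v (snd p))"
    by (rule sum.swap_restrict[OF finite_diffset]) (simp add: fin)
  also have "\<dots> = (\<Sum>p\<in>V \<times> V. u (fst p) * v (snd p) * rep V (fst p \<otimes> inv (snd p)))"
    by (intro sum.cong refl) (auto simp: card_common_slice)
  finally show ?thesis by (simp only: sum_Times fst_conv snd_conv)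
qed

text \<open>The mixed additive energy of \<open>V\<close> and its slice. By
  \<open>sum_rep_commute\<close> it is also a squared convolution norm, so the convolution
  inequality applies to it.\<close>

definition slice_energy :: "'a \<Rightarrow> real" where
  "slice_energy d = (\<Sum>b\<in>slice V d. \<Sum>b'\<in>slice V d. rep V (b \<otimes> inv b'))"

lemma slice_energy_le: "slice_energy d \<le> real (card V) * (rep V d)\<^sup>2"
proof -
  have "slice_energy d \<le> (\<Sum>b\<in>slice V d. \<Sum>b'\<in>slice V d. real (card V))"
    unfolding slice_energy_def by (intro sum_mono rep_le_card)
  thus ?thesis by (simp add: rep_def power2_eq_square mult_ac)
qed

lemma card_slice_inter_power2:
  "(real (card (slice V x \<inter> slice V y)))\<^sup>2
     = (\<Sum>p\<in>{p \<in> V \<times> V. (fst p \<in> slice V x \<and> snd p \<in> slice V x) \<and> (fst p \<in> slice V y \<and> snd p \<in> slice V y)}. 1)"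
proof -
  have "{p \<in> V \<times> V. (fst p \<in> slice V x \<and> snd p \<in> slice V x) \<and> (fst p \<in> slice V y \<and> snd p \<in> slice V y)}
      = (slice V x \<inter> slice V y) \<times> (slice V x \<inter> slice V y)"
    by (auto simp: slice_def)
  thus ?thesis by (simp add: card_cartesian_product power2_eq_square)
qed

text \<open>Both sides count pairs \<open>b\<close>, \<open>b'\<close> in \<open>slice V x\<close>
  together with some \<open>y\<close> whose slice contains both; by \<open>card_common_slice\<close>
  there are \<open>rep V (b \<otimes> inv b')\<close> such \<open>y\<close>.\<close>

lemma sum_slice_inter_power2:
  "(\<Sum>y\<in>diffset V. (real (card (slice V x \<inter> slice V y)))\<^sup>2) = slice_energy x"
proof -
  let ?S = "\<lambda>x p. fst p \<in> slice V x \<and> snd p \<in> slice V x"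
  have "(\<Sum>y\<in>diffset V. (real (card (slice V x \<inter> slice V y)))\<^sup>2)
      = (\<Sum>y\<in>diffset V. \<Sum>p\<in>{p \<in> slice V x \<times> slice V x. ?S y p}. 1)"
    unfolding card_slice_inter_power2
    by (intro sum.cong refl) (auto simp: slice_def)
  also have "\<dots> = (\<Sum>p\<in>slice V x \<times> slice V x. \<Sum>y\<in>{y \<in> diffset V. ?S y p}. 1)"
    by (rule sum.swap_restrict[OF finite_diffset]) (simp add: finite_slice)
  also have "\<dots> = (\<Sum>p\<in>slice V x \<times> slice V x. rep V (fst p \<otimes> inv (snd p)))"
    using slice_subset by (intro sum.cong refl) (auto simp: card_common_slice subset_iff)
  finally show ?thesis by (simp only: slice_energy_def sum_Times fst_conv snd_conv)
qed

lemma sum_over_slices: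
  fixes g :: "'a \<Rightarrow> 'a \<Rightarrow> real"
  shows "(\<Sum>x\<in>diffset V. \<Sum>b\<in>slice V x. \<Sum>b'\<in>slice V x. g b b')
       = (\<Sum>b\<in>V. \<Sum>b'\<in>V. rep V (b \<otimes> inv b') * g b b')"
proof -
  let ?S = "\<lambda>x p. fst p \<in> slice V x \<and> snd p \<in> slice V x"
  have "(\<Sum>x\<in>diffset V. \<Sum>b\<in>slice V x. \<Sum>b'\<in>slice V x. g b b')
      = (\<Sum>x\<in>diffset V. \<Sum>p\<in>{p \<in> V \<times> V. ?S x p}. g (fst p) (snd p))"
  proof (rule sum.cong[OF refl])
    fix x
    have "{p \<in> V \<times> V. ?S x p} = slice V x \<times> slice V x" by (auto simp: slice_def)
    thus "(\<Sum>b\<in>slice V x. \<Sum>b'\<in>slice V x. g b b') = (\<Sum>p\<in>{p \<in> V \<times> V. ?S x p}. g (fst p) (snd p))"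
      by (simp only: sum_Times fst_conv snd_conv)
  qed
  also have "\<dots> = (\<Sum>p\<in>V \<times> V. \<Sum>x\<in>{x \<in> diffset V. ?S x p}. g (fst p) (snd p))"
    by (rule sum.swap_restrict[OF finite_diffset]) (simp add: fin)
  also have "\<dots> = (\<Sum>p\<in>V \<times> V. rep V (fst p \<otimes> inv (snd p)) * g (fst p) (snd p))"
    by (intro sum.cong refl) (auto simp: card_common_slice)
  finally show ?thesis by (simp only: sum_Times fst_conv snd_conv)
qed

text \<open>By \<open>sum_diffset_rep\<close> the right-hand side is the third moment of
  \<open>rep V\<close>, so bounds on slice energies become bounds on that moment.\<close>

lemma sum_slice_energy:
  "(\<Sum>x\<in>diffset V. slice_energy x) = (\<Sum>b\<in>V. \<Sum>b'\<in>V. (rep V (b \<otimes> inv b'))\<^sup>2)"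
  by (simp add: slice_energy_def sum_over_slices power2_eq_square)

text \<open>A triple is parametrised by \<open>b\<close>, \<open>x = a \<otimes> inv b\<close> and
  \<open>y = c \<otimes> inv b\<close>. That \<open>a\<close> and \<open>c\<close> lie in
  \<open>V\<close> says that \<open>b\<close> is in both slices, and
  \<open>a \<otimes> inv c = x \<otimes> inv y\<close>.\<close>

lemma sum_triples_eq:
  fixes h g :: "'a \<Rightarrow> real"
  shows "(\<Sum>b\<in>V. \<Sum>a\<in>V. \<Sum>c\<in>V. h (a \<otimes> inv b) * h (c \<otimes> inv b) * g (a \<otimes> inv c))
       = (\<Sum>x\<in>diffset V. \<Sum>y\<in>diffset V. real (card (slice V x \<inter> slice V y)) * (h x * h y * g (x \<otimes> inv y)))"
proof -
  let ?D = "diffset V"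
  have "(\<Sum>b\<in>V. \<Sum>a\<in>V. \<Sum>c\<in>V. h (a \<otimes> inv b) * h (c \<otimes> inv b) * g (a \<otimes> inv c))
      = (\<Sum>b\<in>V. \<Sum>p\<in>{p \<in> ?D \<times> ?D. b \<in> slice V (fst p) \<and> b \<in> slice V (snd p)}.
           h (fst p) * h (snd p) * g (fst p \<otimes> inv (snd p)))"
  proof (rule sum.cong[OF refl])
    fix b assume b: "b \<in> V"
    have "(\<Sum>a\<in>V. \<Sum>c\<in>V. h (a \<otimes> inv b) * h (c \<otimes> inv b) * g (a \<otimes> inv c))
        = (\<Sum>a\<in>V. \<Sum>c\<in>V. h (a \<otimes> inv b) * h (c \<otimes> inv b) * g ((a \<otimes> inv b) \<otimes> inv (c \<otimes> inv b)))"
    proof (intro sum.cong refl)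
      fix a c assume "a \<in> V" "c \<in> V"
      hence "(a \<otimes> inv b) \<otimes> inv (c \<otimes> inv b) = a \<otimes> inv c"
        using carrier_V b by (simp add: inv_mult m_ac mult_inv_cancel mult_mult_inv_cancel)
      thus "h (a \<otimes> inv b) * h (c \<otimes> inv b) * g (a \<otimes> inv c)
          = h (a \<otimes> inv b) * h (c \<otimes> inv b) * g ((a \<otimes> inv b) \<otimes> inv (c \<otimes> inv b))" by simp
    qed
    also have "\<dots> = (\<Sum>x\<in>{x \<in> ?D. b \<in> slice V x}. \<Sum>c\<in>V. h x * h (c \<otimes> inv b) * g (x \<otimes> inv (c \<otimes> inv b)))"
      by (rule sum_diff_left[OF b, of "\<lambda>x. \<Sum>c\<in>V. h x * h (c \<otimes> inv b) * g (x \<otimes> inv (c \<otimes> inv b))"])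
    also have "\<dots> = (\<Sum>x\<in>{x \<in> ?D. b \<in> slice V x}. \<Sum>y\<in>{x \<in> ?D. b \<in> slice V x}. h x * h y * g (x \<otimes> inv y))"
      by (rule sum.cong[OF refl], rule sum_diff_left[OF b])
    also have "\<dots> = (\<Sum>p\<in>{x \<in> ?D. b \<in> slice V x} \<times> {x \<in> ?D. b \<in> slice V x}.
           h (fst p) * h (snd p) * g (fst p \<otimes> inv (snd p)))"
      by (simp only: sum_Times fst_conv snd_conv)
    also have "{x \<in> ?D. b \<in> slice V x} \<times> {x \<in> ?D. b \<in> slice V x}
        = {p \<in> ?D \<times> ?D. b \<in> slice V (fst p) \<and> b \<in> slice V (snd p)}" by auto
    finally show "(\<Sum>a\<in>V. \<Sum>c\<in>V. h (a \<otimes> inv b) * h (c \<otimes> inv b) * g (a \<otimes> inv c))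
      = (\<Sum>p\<in>{p \<in> ?D \<times> ?D. b \<in> slice V (fst p) \<and> b \<in> slice V (snd p)}.
           h (fst p) * h (snd p) * g (fst p \<otimes> inv (snd p)))" .
  qed
  also have "\<dots> = (\<Sum>p\<in>?D \<times> ?D. \<Sum>b\<in>{b \<in> V. b \<in> slice V (fst p) \<and> b \<in> slice V (snd p)}.
           h (fst p) * h (snd p) * g (fst p \<otimes> inv (snd p)))"
    by (rule sum.swap_restrict[OF fin]) (simp add: finite_diffset)
  also have "\<dots> = (\<Sum>p\<in>?D \<times> ?D. real (card (slice V (fst p) \<inter> slice V (snd p)))
           * (h (fst p) * h (snd p) * g (fst p \<otimes> inv (snd p))))"
  proof (rule sum.cong[OF refl])
    fix p
    have "{b \<in> V. b \<in> slice V (fst p) \<and> b \<in> slice V (snd p)} = slice V (fst p) \<inter> slice V (snd p)"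
      by (auto simp: slice_def)
    thus "(\<Sum>b\<in>{b \<in> V. b \<in> slice V (fst p) \<and> b \<in> slice V (snd p)}.
           h (fst p) * h (snd p) * g (fst p \<otimes> inv (snd p)))
        = real (card (slice V (fst p) \<inter> slice V (snd p)))
           * (h (fst p) * h (snd p) * g (fst p \<otimes> inv (snd p)))" by simp
  qed
  finally show ?thesis by (simp only: sum_Times fst_conv snd_conv)
qed

text \<open>Expanding the square gives pairs \<open>b\<close>, \<open>b'\<close> in both slices. For
  a fixed pair, \<open>x \<otimes> b\<close> and \<open>y \<otimes> b\<close> run independently
  through \<open>slice V (b' \<otimes> inv b)\<close> and keep their difference.\<close>

lemma sum_slice_inter_power2_rep:
  "(\<Sum>x\<in>diffset V. \<Sum>y\<in>diffset V. (real (card (slice V x \<inter> slice V y)))\<^sup>2 * rep V (x \<otimes> inv y))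
     = (\<Sum>b\<in>V. \<Sum>b'\<in>V. slice_energy (b' \<otimes> inv b))"
proof -
  let ?D = "diffset V"
  let ?S = "\<lambda>x p. fst p \<in> slice V x \<and> snd p \<in> slice V x"
  have "(\<Sum>x\<in>?D. \<Sum>y\<in>?D. (real (card (slice V x \<inter> slice V y)))\<^sup>2 * rep V (x \<otimes> inv y))
     = (\<Sum>z\<in>?D \<times> ?D. \<Sum>p\<in>{p \<in> V \<times> V. ?S (fst z) p \<and> ?S (snd z) p}. rep V (fst z \<otimes> inv (snd z)))"
    unfolding card_slice_inter_power2 sum_Times fst_conv snd_conv sum_distrib_right by simp
  also have "\<dots> = (\<Sum>p\<in>V \<times> V. \<Sum>z\<in>{z \<in> ?D \<times> ?D. ?S (fst z) p \<and> ?S (snd z) p}. rep V (fst z \<otimes> inv (snd z)))"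
    by (rule sum.swap_restrict) (simp_all add: finite_diffset fin)
  also have "\<dots> = (\<Sum>p\<in>V \<times> V. slice_energy (snd p \<otimes> inv (fst p)))"
  proof (rule sum.cong[OF refl])
    fix p assume "p \<in> V \<times> V"
    then obtain b b' where p: "p = (b, b')" and b: "b \<in> V" "b' \<in> V" by auto
    let ?B = "{x \<in> ?D. b \<in> slice V x \<and> b' \<in> slice V x}"
    have "{z \<in> ?D \<times> ?D. ?S (fst z) p \<and> ?S (snd z) p} = ?B \<times> ?B" by (auto simp: p)
    hence "(\<Sum>z\<in>{z \<in> ?D \<times> ?D. ?S (fst z) p \<and> ?S (snd z) p}. rep V (fst z \<otimes> inv (snd z)))
        = (\<Sum>x\<in>?B. \<Sum>y\<in>?B. rep V (x \<otimes> inv y))"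
      by (simp only: sum_Times fst_conv snd_conv)
    also have "\<dots> = (\<Sum>x\<in>?B. \<Sum>y\<in>?B. rep V ((x \<otimes> b) \<otimes> inv (y \<otimes> b)))"
    proof (intro sum.cong refl)
      fix x y assume "x \<in> ?B" "y \<in> ?B"
      hence "x \<in> carrier G" "y \<in> carrier G" using diffset_closed by auto
      hence "(x \<otimes> b) \<otimes> inv (y \<otimes> b) = x \<otimes> inv y"
        using carrier_V[OF b(1)] by (simp add: inv_mult m_ac mult_inv_cancel mult_mult_inv_cancel)
      thus "rep V (x \<otimes> inv y) = rep V ((x \<otimes> b) \<otimes> inv (y \<otimes> b))" by simp
    qed
    also have "\<dots> = (\<Sum>x\<in>?B. \<Sum>v\<in>slice V (b' \<otimes> inv b). rep V ((x \<otimes> b) \<otimes> inv v))"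
      by (rule sum.cong[OF refl], rule sum_common_slice[OF b])
    also have "\<dots> = slice_energy (b' \<otimes> inv b)"
      unfolding slice_energy_def
      by (rule sum_common_slice[OF b, of "\<lambda>u. \<Sum>v\<in>slice V (b' \<otimes> inv b). rep V (u \<otimes> inv v)"])
    finally show "(\<Sum>z\<in>{z \<in> ?D \<times> ?D. ?S (fst z) p \<and> ?S (snd z) p}. rep V (fst z \<otimes> inv (snd z)))
        = slice_energy (snd p \<otimes> inv (fst p))" by (simp add: p)
  qed
  finally show ?thesis by (simp only: sum_Times fst_conv snd_conv)
qed

end

section \<open>Mixed energies, convolution norms and additive energy in terms of
  \<open>rep\<close>\<close>

lemma rep_eq_sum:
  assumes "finite V"
  shows "rep V d = (\<Sum>x\<in>V. \<Sum>y\<in>V. of_bool (d \<otimes> y = x))"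
proof -
  have "(\<Sum>x\<in>V. \<Sum>y\<in>V. of_bool (d \<otimes> y = x)) = (\<Sum>y\<in>V. \<Sum>x\<in>V. of_bool (d \<otimes> y = x) :: real)"
    by (rule sum.swap)
  also have "\<dots> = (\<Sum>y\<in>V. of_bool (d \<otimes> y \<in> V))"
    using assms by (intro sum.cong refl) (simp add: of_bool_def)
  also have "\<dots> = rep V d"
    using assms by (simp add: rep_def slice_def Int_def)
  finally show ?thesis by simp
qed

text \<open>Both sides count the solutions of
  \<open>b \<otimes> inv b' = x \<otimes> inv y\<close>.\<close>

lemma sum_rep_commute:
  assumes "finite U" "U \<subseteq> carrier G" "finite V" "V \<subseteq> carrier G"
  shows "(\<Sum>b\<in>U. \<Sum>b'\<in>U. rep V (b \<otimes> inv b')) = (\<Sum>x\<in>V. \<Sum>y\<in>V. rep U (x \<otimes> inv y))"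
proof -
  have "(\<Sum>b\<in>U. \<Sum>b'\<in>U. rep V (b \<otimes> inv b'))
      = (\<Sum>p\<in>U \<times> U. \<Sum>q\<in>V \<times> V. of_bool (fst p \<otimes> inv (snd p) \<otimes> snd q = fst q))"
    using assms by (simp only: rep_eq_sum sum_Times fst_conv snd_conv)
  also have "\<dots> = (\<Sum>p\<in>U \<times> U. \<Sum>q\<in>V \<times> V. of_bool (fst q \<otimes> inv (snd q) \<otimes> snd p = fst p))"
  proof (intro sum.cong refl arg_cong[where f = of_bool])
    fix p q assume "p \<in> U \<times> U" "q \<in> V \<times> V"
    then obtain b b' x y where pq: "p = (b, b')" "q = (x, y)"
      and c: "b \<in> carrier G" "b' \<in> carrier G" "x \<in> carrier G" "y \<in> carrier G" using assms(2,4) by blast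
    have "b \<otimes> inv b' \<otimes> y = x \<longleftrightarrow> x \<otimes> inv y = b \<otimes> inv b'"
      using c diff_eq_iff[of x y "b \<otimes> inv b'"] by auto
    also have "\<dots> \<longleftrightarrow> x \<otimes> inv y \<otimes> b' = b"
      using c diff_eq_iff[of b b' "x \<otimes> inv y"] by auto
    finally show "(fst p \<otimes> inv (snd p) \<otimes> snd q = fst q) = (fst q \<otimes> inv (snd q) \<otimes> snd p = fst p)"
      by (simp add: pq)
  qed
  also have "\<dots> = (\<Sum>q\<in>V \<times> V. \<Sum>p\<in>U \<times> U. of_bool (fst q \<otimes> inv (snd q) \<otimes> snd p = fst p))"
    by (rule sum.swap)
  finally show ?thesis using assms by (simp only: rep_eq_sum sum_Times fst_conv snd_conv)
qed

text \<open>Both sides count solutions of \<open>x \<otimes> inv y = a \<otimes> inv b\<close> with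
  \<open>a\<close>, \<open>b\<close> in \<open>V\<close>, weighted by \<open>f x * f y\<close>. The
  triangle estimates use the convolution inequality in this form.\<close>

lemma conv_norm2_eq_rep:
  assumes "finite F" "F \<subseteq> carrier G" "\<And>x. x \<notin> F \<Longrightarrow> f x = 0" "finite V" "V \<subseteq> carrier G"
  shows "conv_norm2 f F V = (\<Sum>x\<in>F. \<Sum>y\<in>F. f x * f y * rep V (x \<otimes> inv y))"
proof -
  have "conv_norm2 f F V = (\<Sum>p\<in>V \<times> V. \<Sum>x\<in>F. f x * f (x \<otimes> (inv (fst p) \<otimes> snd p)))"
    by (simp only: conv_norm2_def autocorr_def sum_Times fst_conv snd_conv)
  also have "\<dots> = (\<Sum>p\<in>V \<times> V. \<Sum>q\<in>F \<times> F. f (fst q) * f (snd q) * of_bool (fst q \<otimes> inv (snd q) \<otimes> snd p = fst p))"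
    unfolding sum_Times[of _ F F] fst_conv snd_conv
  proof (intro sum.cong refl)
    fix p x assume "p \<in> V \<times> V" and xF: "x \<in> F"
    then obtain a b where p: "p = (a, b)" and c: "a \<in> carrier G" "b \<in> carrier G" "x \<in> carrier G"
      using assms(2,5) by blast
    have "(\<Sum>y\<in>F. f x * f y * of_bool (x \<otimes> inv y \<otimes> b = a))
        = (\<Sum>y\<in>F. if x \<otimes> (inv a \<otimes> b) = y then f x * f y else 0)"
    proof (intro sum.cong refl)
      fix y assume "y \<in> F"
      hence y: "y \<in> carrier G" using assms by auto
      have "x \<otimes> inv y \<otimes> b = a \<longleftrightarrow> (x \<otimes> b) \<otimes> inv y = a"
        using c y by (simp add: m_ac)
      also have "\<dots> \<longleftrightarrow> (x \<otimes> b) \<otimes> inv a = y"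
        using c y diff_eq_iff[of "x \<otimes> b" y a] diff_eq_iff[of "x \<otimes> b" a y] by (simp add: m_comm)
      also have "\<dots> \<longleftrightarrow> x \<otimes> (inv a \<otimes> b) = y"
        using c y by (simp add: m_ac)
      finally show "f x * f y * of_bool (x \<otimes> inv y \<otimes> b = a) = (if x \<otimes> (inv a \<otimes> b) = y then f x * f y else 0)"
        by simp
    qed
    also have "\<dots> = f x * f (x \<otimes> (inv a \<otimes> b))" using assms by simp
    finally show "f x * f (x \<otimes> (inv (fst p) \<otimes> snd p)) = (\<Sum>y\<in>F. f x * f y * of_bool (x \<otimes> inv y \<otimes> snd p = fst p))"
      by (simp add: p)
  qed
  also have "\<dots> = (\<Sum>q\<in>F \<times> F. \<Sum>p\<in>V \<times> V. f (fst q) * f (snd q) * of_bool (fst q \<otimes> inv (snd q) \<otimes> snd p = fst p))"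
    by (rule sum.swap)
  also have "\<dots> = (\<Sum>q\<in>F \<times> F. f (fst q) * f (snd q) * rep V (fst q \<otimes> inv (snd q)))"
    using assms by (simp only: rep_eq_sum sum_distrib_left sum_Times[of _ V V] fst_conv snd_conv)
  finally show ?thesis by (simp only: sum_Times fst_conv snd_conv)
qed

text \<open>\<open>a1 \<otimes> a2 = a3 \<otimes> a4\<close> says that translation by
  \<open>a1 \<otimes> inv a3\<close> sends \<open>a2\<close> to \<open>a4\<close>, so a solution
  amounts to \<open>a1\<close>, \<open>a3\<close> and a point of a slice.\<close>

lemma additive_energy_eq_sum_rep:
  assumes "finite V" "V \<subseteq> carrier G"
  shows "real (additive_energy G V) = (\<Sum>b\<in>V. \<Sum>a\<in>V. rep V (a \<otimes> inv b))"
proof -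
  let ?T = "{(a1, a2, a3, a4). a1 \<in> V \<and> a2 \<in> V \<and> a3 \<in> V \<and> a4 \<in> V \<and> a1 \<otimes> a2 = a3 \<otimes> a4}"
  have "(\<Sum>b\<in>V. \<Sum>a\<in>V. rep V (a \<otimes> inv b)) = (\<Sum>p\<in>V \<times> V. real (card (slice V (snd p \<otimes> inv (fst p)))))"
    by (simp only: sum_Times fst_conv snd_conv rep_def)
  also have "\<dots> = real (card (SIGMA p:V \<times> V. slice V (snd p \<otimes> inv (fst p))))"
    using assms by (subst card_SigmaI) (auto simp: slice_def)
  also have "card (SIGMA p:V \<times> V. slice V (snd p \<otimes> inv (fst p))) = card ?T"
  proof (rule bij_betw_same_card[of "\<lambda>((b, a), c). (a, c, b, a \<otimes> inv b \<otimes> c)"],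
      rule bij_betw_byWitness[where f' = "\<lambda>(a1, a2, a3, a4). ((a3, a1), a2)"])
    show "(\<lambda>((b, a), c). (a, c, b, a \<otimes> inv b \<otimes> c)) ` (SIGMA p:V \<times> V. slice V (snd p \<otimes> inv (fst p))) \<subseteq> ?T"
    proof clarsimp
      fix a b c assume *: "b \<in> V" "a \<in> V" "c \<in> slice V (a \<otimes> inv b)"
      hence "a \<in> carrier G" "b \<in> carrier G" "c \<in> carrier G" using assms by (auto simp: slice_def)
      thus "c \<in> V \<and> a \<otimes> inv b \<otimes> c \<in> V \<and> a \<otimes> c = b \<otimes> (a \<otimes> inv b \<otimes> c)"
        using * by (simp add: slice_def m_ac mult_inv_cancel mult_mult_inv_cancel)
    qed
    have key: "a \<otimes> inv b \<otimes> c = d" if "a \<in> V" "b \<in> V" "c \<in> V" "d \<in> V" "a \<otimes> c = b \<otimes> d" for a b c d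
    proof -
      have cc: "a \<in> carrier G" "b \<in> carrier G" "c \<in> carrier G" "d \<in> carrier G" using that assms by auto
      have "a \<otimes> inv b \<otimes> c = inv b \<otimes> (a \<otimes> c)" using cc by (simp add: m_ac)
      also have "\<dots> = d" using cc that by (simp add: m_assoc[symmetric])
      finally show ?thesis .
    qed
    show "\<forall>t\<in>?T. (\<lambda>((b, a), c). (a, c, b, a \<otimes> inv b \<otimes> c)) ((\<lambda>(a1, a2, a3, a4). ((a3, a1), a2)) t) = t"
      by (auto simp: key)
    show "(\<lambda>(a1, a2, a3, a4). ((a3, a1), a2)) ` ?T \<subseteq> (SIGMA p:V \<times> V. slice V (snd p \<otimes> inv (fst p)))"
      by (auto simp: key slice_def)
  qed auto
  finally show ?thesis by (simp add: additive_energy_def)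
qed


section \<open>Weighted triangles in one finite set\<close>

context
  fixes V :: "'a set"
  assumes fin: "finite V" and sub: "V \<subseteq> carrier G"
begin

text \<open>Weighted triangles are bounded from below because \<open>rep V\<close> is a positive
  semidefinite kernel; only two of the three edges need to carry the truncated weight.\<close>

lemma sum_triples_ge:
  assumes h: "\<And>d. 0 \<le> h d" "\<And>d. h d \<le> rep V d"
  shows "(\<Sum>d\<in>diffset V. rep V d * h d) ^ 4
    \<le> real (card V) ^ 3 * (\<Sum>d\<in>diffset V. (rep V d)\<^sup>2)
       * (\<Sum>b\<in>V. \<Sum>a\<in>V. \<Sum>c\<in>V. h (a \<otimes> inv b) * h (c \<otimes> inv b) * rep V (a \<otimes> inv c))"
proof -
  define n where "n = real (card V)"
  define u where "u a = (\<Sum>b\<in>V. h (a \<otimes> inv b))" for a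
  define W where "W z = (\<Sum>a\<in>slice V z. 1 :: real)" for z
  define U where "U z = (\<Sum>a\<in>slice V z. u a)" for z
  define Ub where "Ub b z = (\<Sum>a\<in>slice V z. h (a \<otimes> inv b))" for b z
  define E where "E = (\<Sum>d\<in>diffset V. (rep V d)\<^sup>2)"
  define R where "R = (\<Sum>b\<in>V. \<Sum>a\<in>V. \<Sum>c\<in>V. h (a \<otimes> inv b) * h (c \<otimes> inv b) * rep V (a \<otimes> inv c))"
  \<comment> \<open>The bilinear form of the kernel \<open>rep V\<close> at \<open>u\<close> and the
    constant function 1.\<close>
  define \<Phi> where "\<Phi> = (\<Sum>a\<in>V. \<Sum>c\<in>V. u a * 1 * rep V (a \<otimes> inv c))"
  have n0: "n \<ge> 0" by (simp add: n_def)
  have u0: "u a \<ge> 0" for a using h by (auto simp: u_def intro: sum_nonneg)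
  have ES: "(\<Sum>d\<in>diffset V. rep V d * h d) = (\<Sum>a\<in>V. u a * 1)"
    using sum.swap[of "\<lambda>a b. h (a \<otimes> inv b)" V V] by (simp add: sum_diffset_rep[OF fin sub] u_def)
  have 1: "(\<Sum>d\<in>diffset V. rep V d * h d)\<^sup>2 \<le> (\<Sum>a\<in>V. (u a)\<^sup>2) * n"
    unfolding ES using sum_mult_power2_le[of u "\<lambda>_. 1" V] by (simp add: n_def)
  have "(\<Sum>a\<in>V. (u a)\<^sup>2) \<le> \<Phi>"
    unfolding \<Phi>_def
  proof (rule sum_mono)
    fix a assume "a \<in> V"
    \<comment> \<open>Here \<open>h \<le> rep V\<close> turns one factor \<open>u a\<close> into a
      row sum of the kernel.\<close>
    have "(u a)\<^sup>2 \<le> u a * (\<Sum>c\<in>V. rep V (a \<otimes> inv c))"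
      unfolding power2_eq_square using h u0 by (intro mult_left_mono) (auto simp: u_def intro: sum_mono)
    thus "(u a)\<^sup>2 \<le> (\<Sum>c\<in>V. u a * 1 * rep V (a \<otimes> inv c))" by (simp add: sum_distrib_left)
  qed
  hence 2: "(\<Sum>a\<in>V. (u a)\<^sup>2) * n \<le> \<Phi> * n" using n0 by (rule mult_right_mono)
  have "\<Phi> = (\<Sum>z\<in>diffset V. U z * W z)"
    unfolding \<Phi>_def U_def W_def by (rule rep_form_eq[OF fin sub])
  hence "\<Phi>\<^sup>2 \<le> (\<Sum>z\<in>diffset V. (U z)\<^sup>2) * (\<Sum>z\<in>diffset V. (W z)\<^sup>2)"
    by (simp add: sum_mult_power2_le)
  also have "(\<Sum>z\<in>diffset V. (W z)\<^sup>2) = E" by (simp add: W_def E_def rep_def)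
  \<comment> \<open>\<open>U z\<close> is a sum of \<open>n\<close> terms, one for each
    \<open>b\<close>. Cauchy-Schwarz over \<open>b\<close> leads to the triangles, because for fixed
    \<open>b\<close> the form is again a sum of squares over slices.\<close>
  also have "(\<Sum>z\<in>diffset V. (U z)\<^sup>2) \<le> (\<Sum>z\<in>diffset V. (\<Sum>b\<in>V. Ub b z * Ub b z) * n)"
  proof (rule sum_mono)
    fix z
    have "U z = (\<Sum>b\<in>V. Ub b z * 1)"
      unfolding U_def u_def Ub_def by (subst sum.swap) simp
    thus "(U z)\<^sup>2 \<le> (\<Sum>b\<in>V. Ub b z * Ub b z) * n"
      using sum_mult_power2_le[of "\<lambda>b. Ub b z" "\<lambda>_. 1" V] by (simp add: n_def power2_eq_square)
  qed
  also have "\<dots> = (\<Sum>b\<in>V. \<Sum>z\<in>diffset V. Ub b z * Ub b z) * n"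
    unfolding sum_distrib_right[symmetric] by (simp only: sum.swap[of _ V])
  also have "(\<Sum>b\<in>V. \<Sum>z\<in>diffset V. Ub b z * Ub b z) = R"
    unfolding R_def Ub_def by (intro sum.cong refl rep_form_eq[OF fin sub, symmetric])
  finally have 3: "\<Phi>\<^sup>2 \<le> R * n * E"
    by (simp add: E_def mult_right_mono sum_nonneg)
  have "((\<Sum>d\<in>diffset V. rep V d * h d)\<^sup>2)\<^sup>2 \<le> (\<Phi> * n)\<^sup>2"
    using order.trans[OF 1 2] by (intro power_mono) auto
  also have "\<dots> \<le> R * n * E * n\<^sup>2"
    using 3 by (simp add: power_mult_distrib mult_right_mono)
  also have "\<dots> = n ^ 3 * E * R" by (simp add: power2_eq_square power3_eq_cube mult_ac)
  finally show ?thesis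
    by (simp add: n_def E_def R_def power_mult[symmetric])
qed

section \<open>Consequences of small slice energies\<close>

context
  fixes n M m :: real
  assumes n_def: "n = real (card V)" and n0: "n > 0" and M: "M \<ge> 2" and m: "m > 0"
    and slice_energy: "\<And>d. slice_energy V d \<le> n * ((rep V d)\<^sup>2 / M + 2 * m\<^sup>2)"
begin

text \<open>Where \<open>rep V d \<ge> m\<close>, the error \<open>2 * m\<^sup>2\<close> is at most
  \<open>2 * m * rep V d\<close>; below \<open>m\<close> the trivial bound
  \<open>slice_energy_le\<close> is already of that order. The values of \<open>rep V\<close> sum to
  \<open>n\<^sup>2\<close>.\<close>

lemma sum_rep_power3_le:
  "(\<Sum>b\<in>V. \<Sum>b'\<in>V. (rep V (b \<otimes> inv b'))\<^sup>2)
     \<le> n / M * (\<Sum>d\<in>diffset V. (rep V d)\<^sup>2) + 3 * m * n ^ 3"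
proof -
  have bound: "slice_energy V d \<le> n / M * (rep V d)\<^sup>2 + 3 * m * n * rep V d" for d
  proof (cases "m \<le> rep V d")
    case True
    hence "m * m \<le> m * rep V d" using m by (intro mult_left_mono) auto
    hence "2 * n * (m * m) \<le> 2 * n * (m * rep V d)" by (rule mult_left_mono) (use n0 in simp)
    moreover have "0 \<le> n * (m * rep V d)" using n0 m by simp
    ultimately show ?thesis using slice_energy[of d] by (simp add: algebra_simps power2_eq_square)
  next
    case False
    have "slice_energy V d \<le> n * (rep V d * rep V d)"
      using slice_energy_le[OF fin sub, of d] by (simp add: n_def power2_eq_square)
    also have "n * (rep V d * rep V d) \<le> n * (m * rep V d)"
      using False n0 by (intro mult_left_mono mult_right_mono) auto
    also have "\<dots> \<le> n / M * (rep V d)\<^sup>2 + 3 * m * n * rep V d"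
    proof -
      have "0 \<le> n * (m * rep V d)" "0 \<le> n / M * (rep V d)\<^sup>2" using n0 m M by auto
      thus ?thesis by (simp add: mult_ac)
    qed
    finally show ?thesis .
  qed
  have "(\<Sum>b\<in>V. \<Sum>b'\<in>V. (rep V (b \<otimes> inv b'))\<^sup>2) = (\<Sum>x\<in>diffset V. slice_energy V x)"
    by (rule sum_slice_energy[OF fin sub, symmetric])
  also have "\<dots> \<le> (\<Sum>d\<in>diffset V. n / M * (rep V d)\<^sup>2 + 3 * m * n * rep V d)"
    by (intro sum_mono bound)
  also have "\<dots> = n / M * (\<Sum>d\<in>diffset V. (rep V d)\<^sup>2) + 3 * m * n * n\<^sup>2"
    by (simp only: sum.distrib sum_distrib_left[symmetric] sum_rep[OF fin sub] n_def)
  finally show ?thesis by (simp add: power2_eq_square power3_eq_cube mult_ac)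
qed

text \<open>Cauchy-Schwarz shares the third edge \<open>rep V (x \<otimes> inv y)\<close> equally
  between \<open>P\<close> and \<open>Q\<close>. \<open>P\<close> saves \<open>M\<^sup>2\<close>,
  once from the slice energies and once from the third moment; \<open>Q\<close> saves
  \<open>M\<close> by the convolution inequality for the square of \<open>h\<close>. The lower bound
  \<open>sum_triples_ge\<close> then limits \<open>M ^ 3\<close>.\<close>

lemma low_rep_energy_bound:
  fixes K T :: real
  defines "f \<equiv> \<lambda>d. if rep V d \<le> T then (rep V d)\<^sup>2 else 0"
    and "h \<equiv> \<lambda>d. if rep V d \<le> T then rep V d else 0"
  assumes K: "K \<ge> 1" and T: "T \<ge> 0" and mle: "m \<le> n / (K * M)"
    and E: "(\<Sum>d\<in>diffset V. (rep V d)\<^sup>2) = n ^ 3 / K"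
    and conv: "(\<Sum>x\<in>diffset V. \<Sum>y\<in>diffset V. f x * f y * rep V (x \<otimes> inv y))
                 \<le> (\<Sum>x\<in>diffset V. (f x)\<^sup>2) * (n\<^sup>2 / M + 2 * m\<^sup>2)"
    and low: "(\<Sum>d\<in>diffset V. rep V d * h d) \<ge> n ^ 3 / (2 * K)"
  shows "M ^ 3 * n\<^sup>2 \<le> 3072 * K ^ 4 * T\<^sup>2"
proof -
  define R where "R = (\<Sum>b\<in>V. \<Sum>a\<in>V. \<Sum>c\<in>V. h (a \<otimes> inv b) * h (c \<otimes> inv b) * rep V (a \<otimes> inv c))"
  define k where "k x y = real (card (slice V x \<inter> slice V y))" for x y
  define E3 where "E3 = (\<Sum>b\<in>V. \<Sum>b'\<in>V. (rep V (b \<otimes> inv b'))\<^sup>2)"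
  define P where "P = (\<Sum>x\<in>diffset V. \<Sum>y\<in>diffset V. (k x y)\<^sup>2 * rep V (x \<otimes> inv y))"
  define Q where "Q = (\<Sum>x\<in>diffset V. \<Sum>y\<in>diffset V. f x * f y * rep V (x \<otimes> inv y))"
  have mKM: "m * (K * M) \<le> n" using mle K M by (simp add: field_simps)
  \<comment> \<open>The bound on \<open>m\<close> keeps the error terms within the order of the main
    terms.\<close>
  have m2: "2 * m\<^sup>2 \<le> n\<^sup>2 / M" and m2': "2 * m\<^sup>2 * n ^ 3 \<le> 2 * n ^ 5 / (K * M\<^sup>2)"
  proof -
    have sq: "(m * (K * M))\<^sup>2 \<le> n\<^sup>2" using mKM m K M by (intro power_mono) auto
    have "2 * m\<^sup>2 * M \<le> m\<^sup>2 * (K * M)\<^sup>2"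
    proof -
      have "2 * M \<le> M * M" using M by (intro mult_right_mono) auto
      also have "\<dots> \<le> (K * M) * (K * M)" using K M by (intro mult_mono) auto
      finally have "2 * M \<le> (K * M)\<^sup>2" by (simp add: power2_eq_square)
      hence "m\<^sup>2 * (2 * M) \<le> m\<^sup>2 * (K * M)\<^sup>2" by (intro mult_left_mono) auto
      thus ?thesis by (simp add: mult_ac)
    qed
    thus "2 * m\<^sup>2 \<le> n\<^sup>2 / M" using sq M by (simp add: field_simps power_mult_distrib)
    have "K * M\<^sup>2 \<le> K\<^sup>2 * M\<^sup>2" using K by (intro mult_right_mono) (auto simp: power2_eq_square)
    hence "m\<^sup>2 * (K * M\<^sup>2) \<le> m\<^sup>2 * (K\<^sup>2 * M\<^sup>2)" by (intro mult_left_mono) auto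
    also have "\<dots> \<le> n\<^sup>2" using sq by (simp add: power_mult_distrib)
    finally have "m\<^sup>2 * (K * M\<^sup>2) * (2 * n ^ 3) \<le> n\<^sup>2 * (2 * n ^ 3)" using n0 by (intro mult_right_mono) auto
    also have "n\<^sup>2 * (2 * n ^ 3) = 2 * n ^ 5" by (simp add: power_add[symmetric])
    finally show "2 * m\<^sup>2 * n ^ 3 \<le> 2 * n ^ 5 / (K * M\<^sup>2)" using K M by (simp add: field_simps)
  qed
  have "E3 \<le> n / M * (n ^ 3 / K) + 3 * m * n ^ 3"
    using sum_rep_power3_le by (simp add: E3_def E)
  also have "\<dots> \<le> n / M * (n ^ 3 / K) + 3 * (n / (K * M)) * n ^ 3"
    using mle n0 by (intro add_left_mono mult_right_mono) auto
  also have "\<dots> = 4 * n ^ 4 / (K * M)" using K M by (simp add: field_simps power_numeral_reduce)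
  finally have E3: "E3 \<le> 4 * n ^ 4 / (K * M)" .
  \<comment> \<open>The slice bound leaves a sum of \<open>(rep V)\<^sup>2\<close> over pairs, which
    is \<open>E3\<close>, so \<open>M\<close> is gained a second time.\<close>
  have "P = (\<Sum>b\<in>V. \<Sum>b'\<in>V. slice_energy V (b' \<otimes> inv b))"
    unfolding P_def k_def by (rule sum_slice_inter_power2_rep[OF fin sub])
  also have "\<dots> \<le> (\<Sum>b\<in>V. \<Sum>b'\<in>V. n / M * (rep V (b' \<otimes> inv b))\<^sup>2 + 2 * m\<^sup>2 * n)"
    using slice_energy by (intro sum_mono) (simp add: algebra_simps)
  also have "\<dots> = n / M * E3 + 2 * m\<^sup>2 * n ^ 3"
    unfolding E3_def
    by (subst sum.swap)
      (simp add: sum.distrib sum_distrib_left[symmetric] sum_divide_distrib[symmetric]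
        n_def[symmetric] power2_eq_square power3_eq_cube mult_ac)
  also have "\<dots> \<le> n / M * (4 * n ^ 4 / (K * M)) + 2 * n ^ 5 / (K * M\<^sup>2)"
    using E3 m2' n0 M by (intro add_mono mult_left_mono) auto
  also have "\<dots> = 6 * n ^ 5 / (K * M\<^sup>2)"
    using K M by (simp add: field_simps power_numeral_reduce)
  finally have P: "P \<le> 6 * n ^ 5 / (K * M\<^sup>2)" .
  have "Q \<le> (\<Sum>x\<in>diffset V. (f x)\<^sup>2) * (n\<^sup>2 / M + 2 * m\<^sup>2)"
    unfolding Q_def by (rule conv)
  also have "\<dots> \<le> (T\<^sup>2 * (n ^ 3 / K)) * (2 * (n\<^sup>2 / M))"
  proof (rule mult_mono)
    \<comment> \<open>The truncation trades two of the four factors \<open>rep V x\<close> for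
      \<open>T\<^sup>2\<close> and leaves the energy.\<close>
    have "(f x)\<^sup>2 \<le> T\<^sup>2 * (rep V x)\<^sup>2" for x
      using T by (auto simp: f_def power2_eq_square intro!: mult_mono)
    hence "(\<Sum>x\<in>diffset V. (f x)\<^sup>2) \<le> (\<Sum>x\<in>diffset V. T\<^sup>2 * (rep V x)\<^sup>2)" by (intro sum_mono)
    thus "(\<Sum>x\<in>diffset V. (f x)\<^sup>2) \<le> T\<^sup>2 * (n ^ 3 / K)" by (simp add: sum_distrib_left[symmetric] E)
  qed (use m2 n0 K M in auto)
  also have "\<dots> = 2 * T\<^sup>2 * n ^ 5 / (K * M)" by (simp add: field_simps power_numeral_reduce)
  finally have Q: "Q \<le> 2 * T\<^sup>2 * n ^ 5 / (K * M)" .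
  have Q0: "Q \<ge> 0" by (auto simp: Q_def f_def intro!: sum_nonneg)
  have "R = (\<Sum>z\<in>diffset V \<times> diffset V. (k (fst z) (snd z) * sqrt (rep V (fst z \<otimes> inv (snd z))))
              * (h (fst z) * h (snd z) * sqrt (rep V (fst z \<otimes> inv (snd z)))))"
    unfolding R_def sum_triples_eq[OF fin sub] sum_Times fst_conv snd_conv k_def
    by (intro sum.cong refl) (simp add: mult_ac)
  hence "R\<^sup>2 \<le> (\<Sum>z\<in>diffset V \<times> diffset V. (k (fst z) (snd z) * sqrt (rep V (fst z \<otimes> inv (snd z))))\<^sup>2)
           * (\<Sum>z\<in>diffset V \<times> diffset V. (h (fst z) * h (snd z) * sqrt (rep V (fst z \<otimes> inv (snd z))))\<^sup>2)"
    by (simp only: sum_mult_power2_le)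
  also have "\<dots> = P * Q"
    unfolding sum_Times fst_conv snd_conv P_def Q_def
    by (intro arg_cong2[where f = "(*)"] sum.cong refl)
      (auto simp: power_mult_distrib h_def f_def)
  also have "\<dots> \<le> (6 * n ^ 5 / (K * M\<^sup>2)) * (2 * T\<^sup>2 * n ^ 5 / (K * M))"
    using P Q Q0 n0 K by (intro mult_mono) auto
  also have "\<dots> = 12 * T\<^sup>2 * n ^ 10 / (K\<^sup>2 * M ^ 3)"
    by (simp add: field_simps power_numeral_reduce)
  finally have R2: "R\<^sup>2 \<le> 12 * T\<^sup>2 * n ^ 10 / (K\<^sup>2 * M ^ 3)" .
  \<comment> \<open>The fourth power produces the 16 in the lower bound for \<open>R\<close>;
    squared and multiplied by the 12 above it gives 3072.\<close>
  have "(n ^ 3 / (2 * K)) ^ 4 \<le> (\<Sum>d\<in>diffset V. rep V d * h d) ^ 4"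
    using low n0 K by (intro power_mono) auto
  also have "\<dots> \<le> n ^ 3 * (\<Sum>d\<in>diffset V. (rep V d)\<^sup>2) * R"
    unfolding R_def n_def by (rule sum_triples_ge) (auto simp: h_def)
  also have "\<dots> = n ^ 3 * (n ^ 3 / K) * R" by (simp only: E)
  finally have "n ^ 6 / (16 * K ^ 3) \<le> R"
    using n0 K by (simp add: field_simps power_numeral_reduce)
  hence "(n ^ 6 / (16 * K ^ 3))\<^sup>2 \<le> R\<^sup>2" using n0 K by (intro power_mono) auto
  also note R2
  finally have "n ^ 12 / (256 * K ^ 6) \<le> 12 * T\<^sup>2 * n ^ 10 / (K\<^sup>2 * M ^ 3)"
    by (simp add: power_divide power_mult_distrib power_mult[symmetric])
  hence "n ^ 12 * (K\<^sup>2 * M ^ 3) \<le> 12 * T\<^sup>2 * n ^ 10 * (256 * K ^ 6)"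
    using K M by (simp add: divide_le_eq le_divide_eq mult_ac)
  hence "(n ^ 10 * K\<^sup>2) * (M ^ 3 * n\<^sup>2) \<le> (n ^ 10 * K\<^sup>2) * (3072 * K ^ 4 * T\<^sup>2)"
    by (simp add: power_numeral_reduce mult_ac)
  moreover have "n ^ 10 * K\<^sup>2 > 0" using n0 K by simp
  ultimately show ?thesis by (rule mult_le_cancel_left_pos[THEN iffD1, rotated])
qed

text \<open>At least 7/10 of the triples have three popular differences. The weight
  \<open>1 / sqrt (rep V x * rep V y)\<close> reduces \<open>P\<close> to the sum of
  \<open>rep V\<close>, and its inverse gives \<open>Q\<close> a function \<open>f\<close> with
  \<open>|f|\<^sup>2 \<le> n\<^sup>2\<close>; each of \<open>P\<close> and \<open>Q\<close> saves
  one \<open>M\<close>.\<close>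

lemma popular_pairs_bound:
  fixes \<theta> :: real
  defines "f \<equiv> \<lambda>d. if \<theta> \<le> rep V d then sqrt (rep V d) else 0"
  assumes \<theta>: "\<theta> > 0" and m\<theta>: "2 * m\<^sup>2 \<le> \<theta>\<^sup>2 / M" "\<theta> \<le> n"
    and bad: "(\<Sum>b\<in>V. \<Sum>a\<in>V. of_bool (rep V (a \<otimes> inv b) < \<theta>)) \<le> n\<^sup>2 / 10"
    and conv: "(\<Sum>x\<in>diffset V. \<Sum>y\<in>diffset V. f x * f y * rep V (x \<otimes> inv y))
                 \<le> (\<Sum>x\<in>diffset V. (f x)\<^sup>2) * (n\<^sup>2 / M + 2 * m\<^sup>2)"
  shows "M\<^sup>2 * \<theta> \<le> 9 * n"
proof -
  define \<chi> where "\<chi> d = (of_bool (\<theta> \<le> rep V d) :: real)" for d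
  define \<beta> where "\<beta> d = (of_bool (rep V d < \<theta>) :: real)" for d
  define s where "s d = sqrt (rep V d)" for d
  define k where "k x y = real (card (slice V x \<inter> slice V y))" for x y
  define R where "R = (\<Sum>b\<in>V. \<Sum>a\<in>V. \<Sum>c\<in>V. \<chi> (a \<otimes> inv b) * \<chi> (c \<otimes> inv b) * \<chi> (a \<otimes> inv c))"
  define P where "P = (\<Sum>x\<in>diffset V. \<Sum>y\<in>diffset V. (k x y)\<^sup>2 * \<chi> x * \<chi> y / (s x * s y))"
  define Q where "Q = (\<Sum>x\<in>diffset V. \<Sum>y\<in>diffset V. \<chi> (x \<otimes> inv y) * \<chi> x * \<chi> y * (s x * s y))"
  have s0: "s x \<ge> 0" for x by (simp add: s_def)
  \<comment> \<open>Union bound: each of the three edges is unpopular in at most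
    \<open>n * (n\<^sup>2 / 10)\<close> triples.\<close>
  have "n ^ 3 - 3 * n * (n\<^sup>2 / 10) \<le> n ^ 3 - 3 * n * (\<Sum>b\<in>V. \<Sum>a\<in>V. \<beta> (a \<otimes> inv b))"
    using bad n0 unfolding \<beta>_def by (intro diff_left_mono mult_left_mono) auto
  also have "\<dots> = (\<Sum>b\<in>V. \<Sum>a\<in>V. \<Sum>c\<in>V. 1 - \<beta> (a \<otimes> inv b) - \<beta> (c \<otimes> inv b) - \<beta> (a \<otimes> inv c))"
  proof -
    have 1: "(\<Sum>b\<in>V. \<Sum>a\<in>V. \<Sum>c\<in>V. \<beta> (a \<otimes> inv b)) = n * (\<Sum>b\<in>V. \<Sum>a\<in>V. \<beta> (a \<otimes> inv b))"
      by (simp add: sum_distrib_left n_def)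
    have 2: "(\<Sum>b\<in>V. \<Sum>a\<in>V. \<Sum>c\<in>V. \<beta> (c \<otimes> inv b)) = n * (\<Sum>b\<in>V. \<Sum>a\<in>V. \<beta> (a \<otimes> inv b))"
      by (simp add: sum_distrib_left n_def)
    have 3: "(\<Sum>b\<in>V. \<Sum>a\<in>V. \<Sum>c\<in>V. \<beta> (a \<otimes> inv c)) = n * (\<Sum>b\<in>V. \<Sum>a\<in>V. \<beta> (a \<otimes> inv b))"
      by (simp add: n_def sum.swap[of "\<lambda>a c. \<beta> (a \<otimes> inv c)"])
    have 4: "(\<Sum>b\<in>V. \<Sum>a\<in>V. \<Sum>c\<in>V. 1) = n ^ 3" by (simp add: n_def power3_eq_cube)
    show ?thesis unfolding sum_subtractf 1 2 3 4 by simp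
  qed
  also have "\<dots> \<le> R"
    unfolding R_def by (intro sum_mono) (auto simp: \<beta>_def \<chi>_def)
  finally have R: "7 / 10 * n ^ 3 \<le> R" by (simp add: power2_eq_square power3_eq_cube)
  have split: "k x y * (\<chi> x * \<chi> y * \<chi> (x \<otimes> inv y))
      = (k x y * \<chi> x * \<chi> y / sqrt (s x * s y)) * (\<chi> (x \<otimes> inv y) * \<chi> x * \<chi> y * sqrt (s x * s y))" for x y
    using \<theta> by (auto simp: \<chi>_def s_def)
  have "R = (\<Sum>z\<in>diffset V \<times> diffset V. (k (fst z) (snd z) * \<chi> (fst z) * \<chi> (snd z) / sqrt (s (fst z) * s (snd z)))
         * (\<chi> (fst z \<otimes> inv (snd z)) * \<chi> (fst z) * \<chi> (snd z) * sqrt (s (fst z) * s (snd z))))"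
    unfolding R_def sum_triples_eq[OF fin sub] sum_Times fst_conv snd_conv k_def[symmetric] split ..
  hence "R\<^sup>2 \<le> (\<Sum>z\<in>diffset V \<times> diffset V. (k (fst z) (snd z) * \<chi> (fst z) * \<chi> (snd z) / sqrt (s (fst z) * s (snd z)))\<^sup>2)
       * (\<Sum>z\<in>diffset V \<times> diffset V. (\<chi> (fst z \<otimes> inv (snd z)) * \<chi> (fst z) * \<chi> (snd z) * sqrt (s (fst z) * s (snd z)))\<^sup>2)"
    by (simp only: sum_mult_power2_le)
  also have "\<dots> = P * Q"
    unfolding sum_Times fst_conv snd_conv P_def Q_def
    using s0 by (intro arg_cong2[where f = "(*)"] sum.cong refl)
      (auto simp: power_mult_distrib power_divide \<chi>_def)
  finally have R2: "R\<^sup>2 \<le> P * Q" .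
  have P: "P \<le> 2 * n ^ 3 / M"
  proof -
    \<comment> \<open>AM-GM separates the weights, so that in each half one variable is free and
      \<open>sum_slice_inter_power2\<close> sums over it.\<close>
    have am_gm: "(k x y)\<^sup>2 * \<chi> x * \<chi> y / (s x * s y)
        \<le> ((k x y)\<^sup>2 * (\<chi> x / rep V x) + (k x y)\<^sup>2 * (\<chi> y / rep V y)) / 2" for x y
    proof (cases "\<theta> \<le> rep V x \<and> \<theta> \<le> rep V y")
      case True
      hence pos: "s x > 0" "s y > 0" using \<theta> by (auto simp: s_def)
      have "2 * (1 / s x) * (1 / s y) \<le> (1 / s x)\<^sup>2 + (1 / s y)\<^sup>2" by (rule sum_squares_bound)
      also have "\<dots> = 1 / rep V x + 1 / rep V y" by (simp add: s_def power_divide)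
      finally have "1 / (s x * s y) \<le> (1 / rep V x + 1 / rep V y) / 2" by simp
      hence "(k x y)\<^sup>2 * (1 / (s x * s y)) \<le> (k x y)\<^sup>2 * ((1 / rep V x + 1 / rep V y) / 2)"
        by (rule mult_left_mono) simp
      thus ?thesis using True by (simp add: \<chi>_def algebra_simps)
    qed (auto simp: \<chi>_def)
    have ksym: "k x y = k y x" for x y by (simp add: k_def Int_commute)
    have "P \<le> (\<Sum>x\<in>diffset V. \<Sum>y\<in>diffset V.
                 ((k x y)\<^sup>2 * (\<chi> x / rep V x) + (k x y)\<^sup>2 * (\<chi> y / rep V y)) / 2)"
      unfolding P_def by (intro sum_mono am_gm)
    also have "\<dots> = ((\<Sum>x\<in>diffset V. \<Sum>y\<in>diffset V. (k x y)\<^sup>2 * (\<chi> x / rep V x))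
                   + (\<Sum>x\<in>diffset V. \<Sum>y\<in>diffset V. (k x y)\<^sup>2 * (\<chi> y / rep V y))) / 2"
      by (simp only: sum.distrib sum_divide_distrib[symmetric])
    also have "(\<Sum>x\<in>diffset V. \<Sum>y\<in>diffset V. (k x y)\<^sup>2 * (\<chi> y / rep V y))
        = (\<Sum>x\<in>diffset V. \<Sum>y\<in>diffset V. (k x y)\<^sup>2 * (\<chi> x / rep V x))"
      by (subst sum.swap) (simp only: ksym)
    also have "(\<Sum>x\<in>diffset V. \<Sum>y\<in>diffset V. (k x y)\<^sup>2 * (\<chi> x / rep V x))
        = (\<Sum>x\<in>diffset V. slice_energy V x * (\<chi> x / rep V x))"
      unfolding sum_distrib_right[symmetric] k_def sum_slice_inter_power2[OF fin sub] ..
    also have "\<dots> \<le> (\<Sum>x\<in>diffset V. 2 * n / M * rep V x)"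
    proof (rule sum_mono)
      fix x
      show "slice_energy V x * (\<chi> x / rep V x) \<le> 2 * n / M * rep V x"
      proof (cases "\<theta> \<le> rep V x")
        case True
        hence pos: "rep V x > 0" using \<theta> by simp
        have "2 * m\<^sup>2 \<le> (rep V x)\<^sup>2 / M"
          using m\<theta> True \<theta> M by (intro order.trans[OF m\<theta>(1)] divide_right_mono power_mono) auto
        hence "n * ((rep V x)\<^sup>2 / M + 2 * m\<^sup>2) \<le> n * ((rep V x)\<^sup>2 / M + (rep V x)\<^sup>2 / M)"
          using n0 by (intro mult_left_mono) auto
        hence "slice_energy V x \<le> 2 * n / M * rep V x * rep V x"
          using slice_energy[of x] by (simp add: power2_eq_square algebra_simps)
        thus ?thesis using True pos by (simp add: \<chi>_def divide_le_eq)
      next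
        case False
        thus ?thesis using n0 M by (simp add: \<chi>_def)
      qed
    qed
    also have "\<dots> = 2 * n / M * n\<^sup>2"
      by (simp only: sum_distrib_left[symmetric] sum_rep[OF fin sub] n_def)
    finally show ?thesis by (simp add: power2_eq_square power3_eq_cube)
  qed
  have Q: "Q \<le> 2 * n ^ 4 / (\<theta> * M)"
  proof -
    have "Q \<le> (\<Sum>x\<in>diffset V. \<Sum>y\<in>diffset V. f x * f y * rep V (x \<otimes> inv y) / \<theta>)"
      unfolding Q_def
    proof (intro sum_mono)
      fix x y
      \<comment> \<open>The indicator of a popular third edge is dominated by the kernel divided by
        \<open>\<theta>\<close>, to which \<open>conv\<close> applies.\<close>
      have "\<chi> (x \<otimes> inv y) \<le> rep V (x \<otimes> inv y) / \<theta>"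
        using \<theta> by (auto simp: \<chi>_def)
      hence "\<chi> (x \<otimes> inv y) * (f x * f y) \<le> rep V (x \<otimes> inv y) / \<theta> * (f x * f y)"
        by (rule mult_right_mono) (auto simp: f_def)
      thus "\<chi> (x \<otimes> inv y) * \<chi> x * \<chi> y * (s x * s y) \<le> f x * f y * rep V (x \<otimes> inv y) / \<theta>"
        by (auto simp: f_def \<chi>_def s_def mult_ac)
    qed
    also have "\<dots> = (\<Sum>x\<in>diffset V. \<Sum>y\<in>diffset V. f x * f y * rep V (x \<otimes> inv y)) / \<theta>"
      by (simp only: sum_divide_distrib)
    also have "\<dots> \<le> ((\<Sum>x\<in>diffset V. (f x)\<^sup>2) * (n\<^sup>2 / M + 2 * m\<^sup>2)) / \<theta>"
      using conv \<theta> by (intro divide_right_mono) auto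
    also have "\<dots> \<le> (n\<^sup>2 * (2 * (n\<^sup>2 / M))) / \<theta>"
    proof (intro divide_right_mono mult_mono)
      have "(\<Sum>x\<in>diffset V. (f x)\<^sup>2) \<le> (\<Sum>x\<in>diffset V. rep V x)"
        by (intro sum_mono) (auto simp: f_def)
      thus "(\<Sum>x\<in>diffset V. (f x)\<^sup>2) \<le> n\<^sup>2" by (simp add: sum_rep[OF fin sub] n_def)
      have "\<theta>\<^sup>2 / M \<le> n\<^sup>2 / M" using m\<theta> \<theta> M by (intro divide_right_mono power_mono) auto
      thus "n\<^sup>2 / M + 2 * m\<^sup>2 \<le> 2 * (n\<^sup>2 / M)" using m\<theta> by simp
    qed (use M \<theta> in auto)
    also have "\<dots> = 2 * n ^ 4 / (\<theta> * M)" by (simp add: power_numeral_reduce mult_ac)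
    finally show ?thesis .
  qed
  have Q0: "Q \<ge> 0" using s0 by (auto simp: Q_def \<chi>_def intro!: sum_nonneg)
  have "(7 / 10 * n ^ 3)\<^sup>2 \<le> R\<^sup>2" using R n0 by (intro power_mono) auto
  also have "\<dots> \<le> (2 * n ^ 3 / M) * (2 * n ^ 4 / (\<theta> * M))"
    using R2 P Q Q0 n0 M by (intro order.trans[OF R2] mult_mono) auto
  finally have "49 / 100 * n ^ 6 \<le> 4 * n ^ 7 / (\<theta> * M\<^sup>2)"
    by (simp add: power_numeral_reduce mult_ac)
  hence "49 / 100 * n ^ 6 * (\<theta> * M\<^sup>2) \<le> 4 * n ^ 7"
    using \<theta> M by (simp add: field_simps)
  hence "n ^ 6 * (49 / 100 * (M\<^sup>2 * \<theta>)) \<le> n ^ 6 * (4 * n)"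
    by (simp add: power_numeral_reduce mult_ac)
  hence "49 / 100 * (M\<^sup>2 * \<theta>) \<le> 4 * n"
    using n0 by (subst (asm) mult_le_cancel_left_pos) auto
  thus ?thesis using n0 by simp
qed

end
end

section \<open>Large subsets of small dimension\<close>

text \<open>Coefficients on \<open>L'\<close> extend by zero. This allows cutting a dissociated set
  down to exactly \<open>D\<close> elements.\<close>

lemma dissociated_subset:
  assumes L: "dissociated G L" and L': "L' \<subseteq> L"
  shows "dissociated G L'"
  unfolding dissociated_def
proof (intro conjI allI impI)
  have fL: "finite L" "L \<subseteq> carrier G" using L by (auto simp: dissociated_def)
  show "finite L'" "L' \<subseteq> carrier G" using fL L' by (auto intro: finite_subset)
  fix e :: "'a \<Rightarrow> int"
  assume e: "(\<forall>x\<in>L'. e x \<in> {-1, 0, 1}) \<and> (\<Otimes>x\<in>L'. x [^] e x) = \<one>"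
  define e' where "e' x = (if x \<in> L' then e x else 0)" for x
  have "(\<Otimes>x\<in>L. x [^] e' x) = (\<Otimes>x\<in>L'. x [^] e x)"
    using fL L' by (intro finprod_mono_neutral_cong_right) (auto simp: e'_def)
  moreover have "\<forall>x\<in>L. e' x \<in> {-1, 0, 1}" using e by (auto simp: e'_def)
  ultimately have "\<forall>x\<in>L. e' x = 0" using L e unfolding dissociated_def by metis
  hence "e' x = 0" if "x \<in> L'" for x using L' that by blast
  thus "\<forall>x\<in>L'. e x = 0" by (simp add: e'_def)
qed

lemma additive_dim_attained:
  assumes "finite B"
  obtains L where "L \<subseteq> B" "dissociated G L" "card L = additive_dim G B"
proof -
  let ?S = "{card L | L. L \<subseteq> B \<and> dissociated G L}"
  have "finite ?S" using assms by (rule_tac finite_subset[of _ "card ` Pow B"]) auto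
  moreover have "dissociated G {}" by (simp add: dissociated_def)
  hence "?S \<noteq> {}" by blast
  ultimately have "Max ?S \<in> ?S" by (rule Max_in)
  thus ?thesis using that unfolding additive_dim_def by auto
qed

text \<open>Here \<open>\<kappa> = K powr (1 / 8)\<close>.\<close>

lemma exists_large_subset_of_small_dim:
  fixes \<kappa> :: real
  assumes A: "finite A" "A \<subseteq> carrier G" "card A \<ge> 2"
    and \<kappa>: "\<kappa> > 0"
    and E: "real (additive_energy G A) = real (card A) ^ 3 / \<kappa> ^ 8"
  shows "\<exists>B\<subseteq>A. real (card B) \<ge> 1 / 20000 * real (card A) / \<kappa> ^ 25 \<and>
           real (additive_dim G B) \<le> 1600 * exp 5 * \<kappa> ^ 7 * log 2 (real (card A))"
proof (rule ccontr)
  assume contra: "\<not> ?thesis"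
  define n where "n = real (card A)"
  define K where "K = \<kappa> ^ 8"
  \<comment> \<open>\<open>m\<close> is the size claimed for \<open>B\<close>, and \<open>D\<close>
    exceeds the dimension claimed, so the negated claim makes every subset of at least
    \<open>m\<close> elements contain \<open>D\<close> dissociated ones. As 1600 is 16 times 100,
    \<open>M\<close> satisfies \<open>16 * exp 5 * log 2 n / D \<le> 1 / M\<close>.\<close>
  define m where "m = n / (20000 * \<kappa> ^ 25)"
  define M where "M = 100 * \<kappa> ^ 7"
  define D where "D = nat \<lfloor>1600 * exp 5 * \<kappa> ^ 7 * log 2 n\<rfloor> + 1"
  have n: "n \<ge> 2" using A by (simp add: n_def)
  have energy: "(\<Sum>d\<in>diffset A. (rep A d)\<^sup>2) = n ^ 3 / K"
    using E additive_energy_eq_sum_rep[OF A(1,2)] sum_diffset_rep[OF A(1,2), of "rep A"]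
    by (simp add: power2_eq_square n_def K_def)
  \<comment> \<open>The trivial bound \<open>rep A d \<le> n\<close> on one factor yields
    \<open>K \<ge> 1\<close>, so that powers of \<open>\<kappa>\<close> compare by their
    exponents.\<close>
  have "n ^ 3 / K \<le> (\<Sum>d\<in>diffset A. n * rep A d)"
    unfolding energy[symmetric] power2_eq_square
    using rep_le_card[OF A(1,2)] by (intro sum_mono mult_right_mono) (auto simp: n_def)
  also have "\<dots> = n ^ 3"
    by (simp add: sum_distrib_left[symmetric] sum_rep[OF A(1,2)] n_def power2_eq_square power3_eq_cube)
  finally have "n ^ 3 \<le> n ^ 3 * K" using \<kappa> by (simp add: K_def divide_le_eq)
  hence K1: "K \<ge> 1" using n by simp
  have \<kappa>1: "\<kappa> \<ge> 1"
  proof (rule ccontr)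
    assume "\<not> ?thesis"
    hence "\<kappa> ^ 8 < 1 ^ 8" using \<kappa> by (intro power_strict_mono) auto
    thus False using K1 by (simp add: K_def)
  qed
  have m: "m > 0" using n \<kappa> by (simp add: m_def)
  have M2: "M \<ge> 2" using one_le_power[OF \<kappa>1, of 7] by (simp add: M_def)
  have D: "D > 0" "1600 * exp 5 * \<kappa> ^ 7 * log 2 n \<le> real D"
  proof -
    have "0 \<le> 1600 * exp 5 * \<kappa> ^ 7 * log 2 n" using n \<kappa> by simp
    thus "1600 * exp 5 * \<kappa> ^ 7 * log 2 n \<le> real D" unfolding D_def by linarith
  qed (simp add: D_def)
  have rich: "\<exists>L\<subseteq>B. dissociated G L \<and> card L = D" if B: "B \<subseteq> A" "m \<le> real (card B)" for B
  proof -
    have "1 / 20000 * real (card A) / \<kappa> ^ 25 = m" by (simp add: m_def n_def)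
    hence "\<not> real (additive_dim G B) \<le> 1600 * exp 5 * \<kappa> ^ 7 * log 2 n"
      using contra B unfolding n_def by metis
    moreover have "0 \<le> 1600 * exp 5 * \<kappa> ^ 7 * log 2 n" using n \<kappa> by simp
    ultimately have "D \<le> additive_dim G B"
      unfolding D_def by linarith
    moreover obtain L where L: "L \<subseteq> B" "dissociated G L" "card L = additive_dim G B"
      using additive_dim_attained[of B] A B finite_subset by metis
    ultimately obtain L' where "L' \<subseteq> L" "card L' = D"
      using obtain_subset_with_card_n[of D L] by metis
    thus ?thesis using L dissociated_subset by blast
  qed
  have conv: "(\<Sum>x\<in>F. \<Sum>y\<in>F. f x * f y * rep V (x \<otimes> inv y))
      \<le> (\<Sum>x\<in>F. (f x)\<^sup>2) * ((real (card V))\<^sup>2 / M + 2 * m\<^sup>2)"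
    if V: "V \<subseteq> A" and F: "finite F" "F \<subseteq> carrier G" "card F \<le> (card A)\<^sup>2" and f: "\<And>x. f x \<ge> 0" for V F f
  proof -
    \<comment> \<open>The convolution inequality wants a function vanishing outside
      \<open>F\<close>, while it is to be applied to functions such as the constant 1.\<close>
    define f' where "f' x = (if x \<in> F then f x else 0)" for x
    have fV: "finite V" "V \<subseteq> carrier G" using V A by (auto intro: finite_subset)
    have "(\<Sum>x\<in>F. \<Sum>y\<in>F. f x * f y * rep V (x \<otimes> inv y)) = conv_norm2 f' F V"
      using F fV by (subst conv_norm2_eq_rep) (auto simp: f'_def intro!: sum.cong)
    also have "\<dots> \<le> (\<Sum>x\<in>F. (f' x)\<^sup>2)
        * (16 * exp 5 * log 2 (card A) / real D * (real (card V))\<^sup>2 + 2 * m\<^sup>2)"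
      using F f A m D V
      by (intro conv_norm2_le[where A = A] rich) (auto simp: f'_def)
    also have "\<dots> \<le> (\<Sum>x\<in>F. (f' x)\<^sup>2) * (1 / M * (real (card V))\<^sup>2 + 2 * m\<^sup>2)"
    proof (intro mult_left_mono add_right_mono mult_right_mono)
      have "16 * exp 5 * log 2 n * M \<le> real D"
        using D(2) by (simp add: M_def mult_ac)
      thus "16 * exp 5 * log 2 (card A) / real D \<le> 1 / M"
        using M2 D(1) by (simp add: n_def field_simps)
    qed (auto intro: sum_nonneg)
    also have "(\<Sum>x\<in>F. (f' x)\<^sup>2) = (\<Sum>x\<in>F. (f x)\<^sup>2)" by (simp add: f'_def)
    finally show ?thesis by simp
  qed
  have slice_energy: "slice_energy V d \<le> real (card V) * ((rep V d)\<^sup>2 / M + 2 * m\<^sup>2)" if V: "V \<subseteq> A" for V d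
  proof -
    have fV: "finite V" "V \<subseteq> carrier G" using V A by (auto intro: finite_subset)
    have sl: "slice V d \<subseteq> V" "finite (slice V d)" "slice V d \<subseteq> carrier G" "slice V d \<subseteq> A"
      using fV V by (auto simp: slice_def)
    have "card V \<le> card A" using V A by (simp add: card_mono)
    also have "\<dots> \<le> (card A)\<^sup>2" by (simp add: power2_eq_square)
    finally have cV: "card V \<le> (card A)\<^sup>2" .
    \<comment> \<open>The roles are exchanged: the indicator of \<open>V\<close> is convolved with
      the set \<open>slice V d\<close>.\<close>
    have "slice_energy V d = (\<Sum>x\<in>V. \<Sum>y\<in>V. rep (slice V d) (x \<otimes> inv y))"
      unfolding slice_energy_def[OF fV] by (rule sum_rep_commute[OF sl(2,3) fV])
    also have "\<dots> \<le> (\<Sum>x\<in>V. 1\<^sup>2) * ((real (card (slice V d)))\<^sup>2 / M + 2 * m\<^sup>2)"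
      using conv[OF sl(4) fV cV, of "\<lambda>_. 1"] by simp
    finally show ?thesis by (simp add: rep_def)
  qed
  have conv_diffset: "(\<Sum>x\<in>diffset V. \<Sum>y\<in>diffset V. f x * f y * rep V (x \<otimes> inv y))
      \<le> (\<Sum>x\<in>diffset V. (f x)\<^sup>2) * ((real (card V))\<^sup>2 / M + 2 * m\<^sup>2)"
    if V: "V \<subseteq> A" and f: "\<And>x. f x \<ge> 0" for V f
  proof (rule conv[OF V _ _ _ f])
    have fV: "finite V" "V \<subseteq> carrier G" using V A by (auto intro: finite_subset)
    show "finite (diffset V)" by (rule finite_diffset[OF fV])
    show "diffset V \<subseteq> carrier G" using diffset_closed[OF fV] by auto
    have "card (diffset V) \<le> (card V)\<^sup>2" by (rule card_diffset_le[OF fV])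
    also have "\<dots> \<le> (card A)\<^sup>2" using V A by (simp add: card_mono)
    finally show "card (diffset V) \<le> (card A)\<^sup>2" .
  qed
  \<comment> \<open>Differences with at most \<open>T\<close> representations cannot carry half of the energy, so some slice
      \<open>V\<close> has more than \<open>T\<close> elements and almost all its pairs have a popular difference.\<close>
  define T where "T = n / \<kappa> ^ 6"
  define h where "h d = (if rep A d \<le> T then rep A d else 0)" for d
  have low: "(\<Sum>d\<in>diffset A. rep A d * h d) < n ^ 3 / (2 * K)"
  proof (rule ccontr)
    assume "\<not> ?thesis"
    hence "M ^ 3 * n\<^sup>2 \<le> 3072 * K ^ 4 * T\<^sup>2"
      using n m M2 K1 \<kappa> \<kappa>1
    proof (intro low_rep_energy_bound[OF A(1,2) n_def])
      show "m \<le> n / (K * M)"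
        unfolding m_def
      proof (rule divide_left_mono)
        have "K * M = 100 * \<kappa> ^ 15" by (simp add: K_def M_def power_add[symmetric])
        also have "\<dots> \<le> 20000 * \<kappa> ^ 25" using \<kappa>1 by (intro mult_mono power_increasing) auto
        finally show "K * M \<le> 20000 * \<kappa> ^ 25" .
      qed (use n \<kappa> K1 M2 in auto)
    qed (use n m M2 K1 \<kappa> slice_energy[of A] conv_diffset[of A] energy in
          \<open>auto simp: n_def[symmetric] h_def T_def\<close>)
    also have "K ^ 4 * T\<^sup>2 = \<kappa> ^ 20 * n\<^sup>2"
      using \<kappa> by (simp add: K_def T_def power_divide power_mult[symmetric] field_simps power_add[symmetric])
    hence "3072 * K ^ 4 * T\<^sup>2 = 3072 * \<kappa> ^ 20 * n\<^sup>2" by simp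
    finally have "M ^ 3 \<le> 3072 * \<kappa> ^ 20" using n by simp
    \<comment> \<open>The exponent 7 in \<open>M\<close> is what beats \<open>\<kappa> ^ 20\<close>
      here.\<close>
    moreover have "M ^ 3 = 1000000 * \<kappa> ^ 21" by (simp add: M_def power_mult_distrib power_mult[symmetric])
    moreover have "\<kappa> ^ 20 \<le> \<kappa> ^ 21" using \<kappa>1 by (intro power_increasing) auto
    moreover have "\<kappa> ^ 20 > 0" using \<kappa> by simp
    ultimately show False by linarith
  qed
  define big where "big = {d \<in> diffset A. T < rep A d}"
  \<comment> \<open>A pair lies in \<open>rep A (b \<otimes> inv a)\<close> slices, so the unpopular
    ones contribute at most \<open>n\<^sup>2 * \<theta>0\<close> over all slices. Twenty times this
    is half the energy, and \<open>big\<close> carries more than half; so some slice in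
    \<open>big\<close> has few bad pairs.\<close>
  define \<theta>0 where "\<theta>0 = n / (40 * K)"
  define bad where "bad s = (\<Sum>b\<in>slice A s. \<Sum>a\<in>slice A s. of_bool (rep A (b \<otimes> inv a) < \<theta>0) :: real)" for s
  have bad0: "bad s \<ge> 0" for s by (auto simp: bad_def intro!: sum_nonneg)
  have "(\<Sum>s\<in>diffset A. bad s) = (\<Sum>b\<in>A. \<Sum>a\<in>A. rep A (b \<otimes> inv a) * of_bool (rep A (b \<otimes> inv a) < \<theta>0))"
    unfolding bad_def by (rule sum_over_slices[OF A(1,2)])
  also have "\<dots> \<le> (\<Sum>b\<in>A. \<Sum>a\<in>A. \<theta>0)"
    using n K1 by (intro sum_mono) (auto simp: \<theta>0_def)
  finally have "(\<Sum>s\<in>diffset A. bad s) \<le> n\<^sup>2 * \<theta>0" by (simp add: n_def power2_eq_square)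
  moreover have "(\<Sum>s\<in>big. bad s) \<le> (\<Sum>s\<in>diffset A. bad s)"
    using finite_diffset[OF A(1,2)] bad0 by (intro sum_mono2) (auto simp: big_def)
  moreover have "20 * (n\<^sup>2 * \<theta>0) = n ^ 3 / (2 * K)"
    by (simp add: \<theta>0_def power2_eq_square power3_eq_cube)
  moreover have "(\<Sum>s\<in>big. (rep A s)\<^sup>2) = n ^ 3 / K - (\<Sum>d\<in>diffset A. rep A d * h d)"
  proof -
    have "(\<Sum>s\<in>big. (rep A s)\<^sup>2) = (\<Sum>d\<in>diffset A. if T < rep A d then (rep A d)\<^sup>2 else 0)"
      unfolding big_def using finite_diffset[OF A(1,2)] by (simp add: sum.inter_filter)
    also have "\<dots> = (\<Sum>d\<in>diffset A. (rep A d)\<^sup>2 - rep A d * h d)"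
      by (intro sum.cong refl) (auto simp: h_def power2_eq_square)
    finally show ?thesis by (simp add: sum_subtractf energy)
  qed
  ultimately have "0 < (\<Sum>s\<in>big. (rep A s)\<^sup>2 - 20 * bad s)"
    using low by (simp add: sum_subtractf sum_distrib_left[symmetric])
  then obtain s where s: "s \<in> big" "20 * bad s < (rep A s)\<^sup>2"
    by (metis (no_types, lifting) diff_gt_0_iff_gt not_le sum_nonpos)
  define V where "V = slice A s"
  define p where "p = real (card V)"
  have V: "V \<subseteq> A" "finite V" "V \<subseteq> carrier G" using A by (auto simp: V_def slice_def)
  have pn: "p \<le> n" using V A by (simp add: p_def n_def card_mono)
  have pT: "n / \<kappa> ^ 6 < p" using s by (simp add: big_def T_def p_def V_def rep_def)
  have p0: "p > 0" using pT n \<kappa> by (smt (verit) divide_pos_pos zero_less_power)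
  have np: "n < \<kappa> ^ 6 * p" using pT \<kappa> by (simp add: divide_less_eq mult.commute)
  \<comment> \<open>\<open>W\<close> has at most \<open>n\<^sup>2 / \<theta>0 = 40 * K * n\<close>
    elements, so those with fewer than \<open>\<theta>\<close> representations in \<open>V\<close>
    account for at most \<open>p\<^sup>2 / 20\<close> pairs.\<close>
  define \<theta> where "\<theta> = p\<^sup>2 / (800 * K * n)"
  have \<theta>: "\<theta> > 0" using p0 n K1 by (simp add: \<theta>_def)
  define W where "W = {d \<in> diffset V. \<theta>0 \<le> rep A d}"
  have VA: "diffset V \<subseteq> diffset A" using V(1) by (auto simp: diffset_def)
  have card_W: "real (card W) * \<theta>0 \<le> n\<^sup>2"
  proof -
    have "real (card W) * \<theta>0 \<le> (\<Sum>d\<in>W. rep A d)"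
      using sum_mono[of W "\<lambda>_. \<theta>0" "rep A"] by (simp add: W_def)
    also have "\<dots> \<le> (\<Sum>d\<in>diffset A. rep A d)"
      using VA finite_diffset[OF A(1,2)] by (intro sum_mono2) (auto simp: W_def)
    finally show ?thesis by (simp add: sum_rep[OF A(1,2)] n_def)
  qed
  have "(\<Sum>b\<in>V. \<Sum>a\<in>V. of_bool (rep V (a \<otimes> inv b) < \<theta>))
      \<le> (\<Sum>b\<in>V. \<Sum>a\<in>V. of_bool (rep A (a \<otimes> inv b) < \<theta>0)
            + of_bool (\<theta>0 \<le> rep A (a \<otimes> inv b) \<and> rep V (a \<otimes> inv b) < \<theta>) :: real)"
    by (intro sum_mono) auto
  also have "\<dots> = (\<Sum>b\<in>V. \<Sum>a\<in>V. of_bool (rep A (a \<otimes> inv b) < \<theta>0))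
      + (\<Sum>b\<in>V. \<Sum>a\<in>V. of_bool (\<theta>0 \<le> rep A (a \<otimes> inv b) \<and> rep V (a \<otimes> inv b) < \<theta>))"
    by (simp only: sum.distrib)
  also have "(\<Sum>b\<in>V. \<Sum>a\<in>V. of_bool (rep A (a \<otimes> inv b) < \<theta>0)) = bad s"
    unfolding bad_def V_def by (rule sum.swap)
  also have "(\<Sum>b\<in>V. \<Sum>a\<in>V. of_bool (\<theta>0 \<le> rep A (a \<otimes> inv b) \<and> rep V (a \<otimes> inv b) < \<theta>))
      = (\<Sum>d\<in>diffset V. rep V d * of_bool (\<theta>0 \<le> rep A d \<and> rep V d < \<theta>))"
    by (rule sum_diffset_rep[OF V(2,3), symmetric])
  also have "\<dots> \<le> (\<Sum>d\<in>diffset V. if \<theta>0 \<le> rep A d then \<theta> else 0)"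
    using \<theta> by (intro sum_mono) auto
  also have "\<dots> = real (card W) * \<theta>"
    unfolding W_def using finite_diffset[OF V(2,3)] by (simp add: sum.inter_filter[symmetric])
  also have "\<dots> \<le> p\<^sup>2 / 20"
  proof -
    have "real (card W) * \<theta> = real (card W) * \<theta>0 * (p\<^sup>2 / (20 * n\<^sup>2))"
      using n K1 by (simp add: \<theta>_def \<theta>0_def field_simps power2_eq_square)
    also have "\<dots> \<le> n\<^sup>2 * (p\<^sup>2 / (20 * n\<^sup>2))" using card_W by (rule mult_right_mono) simp
    finally show ?thesis using n by simp
  qed
  also have "bad s + p\<^sup>2 / 20 \<le> p\<^sup>2 / 10" using s by (simp add: p_def V_def rep_def)
  finally have bad_pairs: "(\<Sum>b\<in>V. \<Sum>a\<in>V. of_bool (rep V (a \<otimes> inv b) < \<theta>)) \<le> p\<^sup>2 / 10" by simp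
  have \<theta>_p: "\<theta> \<le> p"
  proof -
    have "p * p \<le> p * (800 * K * n)"
    proof (intro mult_left_mono)
      have "1 * n \<le> 800 * K * n" using K1 n by (intro mult_right_mono) auto
      thus "p \<le> 800 * K * n" using pn by simp
    qed (use p0 in simp)
    thus ?thesis using n K1 by (simp add: \<theta>_def divide_le_eq power2_eq_square)
  qed
  \<comment> \<open>What matters is \<open>n ^ 4 * \<kappa> ^ 23\<close> against
    \<open>p ^ 4 * \<kappa> ^ 50\<close>: the slice size \<open>n < \<kappa> ^ 6 * p\<close> leads
    to exponent 47, and 50 comes from squaring the \<open>\<kappa> ^ 25\<close> in
    \<open>m\<close>.\<close>
  have m_\<theta>: "2 * m\<^sup>2 \<le> \<theta>\<^sup>2 / M"
  proof -
    have "n ^ 4 \<le> (\<kappa> ^ 6 * p) ^ 4" using np n by (intro power_mono) auto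
    also have "\<dots> = \<kappa> ^ 24 * p ^ 4" by (simp add: power_mult_distrib power_mult[symmetric])
    finally have "n ^ 4 * \<kappa> ^ 23 \<le> \<kappa> ^ 24 * p ^ 4 * \<kappa> ^ 23" using \<kappa> by (intro mult_right_mono) auto
    also have "\<dots> = p ^ 4 * \<kappa> ^ 47" by (simp add: power_add[symmetric] mult_ac)
    also have "\<dots> \<le> p ^ 4 * \<kappa> ^ 50" using \<kappa>1 p0 by (intro mult_left_mono power_increasing) auto
    finally have 1: "n ^ 4 * \<kappa> ^ 23 \<le> p ^ 4 * \<kappa> ^ 50" .
    have "\<theta>\<^sup>2 / M = p ^ 4 / (64000000 * \<kappa> ^ 23 * n\<^sup>2)"
      by (simp add: \<theta>_def M_def K_def power_divide power_mult_distrib power_mult[symmetric]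
          power_add[symmetric] mult_ac)
    moreover have "2 * m\<^sup>2 = n\<^sup>2 / (200000000 * \<kappa> ^ 50)"
      by (simp add: m_def power_divide power_mult_distrib power_mult[symmetric])
    moreover have "n\<^sup>2 / (200000000 * \<kappa> ^ 50) \<le> p ^ 4 / (64000000 * \<kappa> ^ 23 * n\<^sup>2)"
    proof -
      have "n\<^sup>2 * (64000000 * \<kappa> ^ 23 * n\<^sup>2) = 64000000 * (n ^ 4 * \<kappa> ^ 23)"
        by (simp add: power_numeral_reduce mult_ac)
      also have "\<dots> \<le> 200000000 * (p ^ 4 * \<kappa> ^ 50)"
      proof -
        have "0 \<le> p ^ 4 * \<kappa> ^ 50" using \<kappa> by simp
        thus ?thesis using 1 by linarith
      qed
      finally show ?thesis using n \<kappa> by (simp add: divide_le_eq le_divide_eq mult_ac)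
    qed
    ultimately show ?thesis by simp
  qed
  \<comment> \<open>Since \<open>M\<^sup>2 * \<theta>\<close> equals
    \<open>25 / 2 * \<kappa> ^ 6 * p\<^sup>2 / n\<close> and 25/2 exceeds 9, this contradicts
    \<open>n < \<kappa> ^ 6 * p\<close>.\<close>
  have "M\<^sup>2 * \<theta> \<le> 9 * p"
    using p0 M2 m \<theta> m_\<theta> \<theta>_p bad_pairs slice_energy[OF V(1)] conv_diffset[OF V(1)]
    by (intro popular_pairs_bound[OF V(2,3) p_def]) (auto simp: p_def[symmetric])
  moreover have "M\<^sup>2 * \<theta> = 25 / 2 * (\<kappa> ^ 6 * p) * p / n"
    using \<kappa> n by (simp add: M_def \<theta>_def K_def power_mult_distrib power_mult[symmetric]
        field_simps power_numeral_reduce)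
  ultimately have "25 / 2 * (\<kappa> ^ 6 * p) * p \<le> 9 * n * p" using n by (simp add: divide_le_eq mult_ac)
  hence "25 / 2 * (\<kappa> ^ 6 * p) \<le> 9 * n" using p0 by simp
  thus False using np n by linarith
qed

end

text \<open>Taking the eighth root requires \<open>K > 0\<close>. The neutral difference has
  \<open>card A\<close> representations, so the energy is positive; this excludes negative
  \<open>K\<close> and also \<open>K = 0\<close>, where the quotient is 0 by convention.\<close>

lemma energy_dim_bounds_explicit: "energy_dim_bounds TYPE('a) (1 / 20000) (1600 * exp 5)"
  unfolding energy_dim_bounds_def
proof (intro allI impI)
  fix G :: "'a monoid" and A :: "'a set" and K :: real
  assume *: "comm_group G \<and> A \<subseteq> carrier G \<and> finite A \<and> card A \<ge> 2 \<and>
        real (additive_energy G A) = real (card A) ^ 3 / K"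
  then interpret comm_group G by simp
  have A: "finite A" "A \<subseteq> carrier G" "card A \<ge> 2"
    and E: "real (additive_energy G A) = real (card A) ^ 3 / K" using * by auto
  obtain a where a: "a \<in> A" using A by fastforce
  have "rep A (a \<otimes>\<^bsub>G\<^esub> inv\<^bsub>G\<^esub> a) = real (card A)"
    using a A by (auto simp: rep_def slice_def subset_iff intro!: arg_cong[of _ _ card])
  hence "0 < (\<Sum>x\<in>A. rep A (x \<otimes>\<^bsub>G\<^esub> inv\<^bsub>G\<^esub> a))"
    using A a by (intro sum_pos2[of A a]) auto
  hence "0 < real (additive_energy G A)"
    unfolding additive_energy_eq_sum_rep[OF A(1,2)]
    by (rule sum_pos2[OF A(1) a]) (simp add: sum_nonneg)
  hence K: "K > 0" using E A by (simp add: zero_less_divide_iff)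
  have pow: "(K powr (1 / 8)) ^ k = K powr (real k / 8)" for k
    using K by (simp add: powr_realpow[symmetric] powr_powr)
  have "\<exists>B\<subseteq>A. real (card B) \<ge> 1 / 20000 * real (card A) / (K powr (1 / 8)) ^ 25 \<and>
           real (additive_dim G B) \<le> 1600 * exp 5 * (K powr (1 / 8)) ^ 7 * log 2 (real (card A))"
    using A E K by (intro exists_large_subset_of_small_dim) (auto simp: pow)
  thus "\<exists>B\<subseteq>A. real (card B) \<ge> 1 / 20000 * real (card A) / K powr (25 / 8) \<and>
           real (additive_dim G B) \<le> 1600 * exp 5 * K powr (7 / 8) * log 2 (real (card A))"
    by (simp add: pow)
qed

context comm_group begin

section \<open>Transfer to groups of natural numbers\<close>

text \<open>The elements are products of words over \<open>A\<close> and the inverses of its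
  elements, and there are countably many such words.\<close>

lemma countable_generate:
  assumes "countable A" "A \<subseteq> carrier G"
  shows "countable (generate G A)"
proof -
  let ?W = "lists (A \<union> m_inv G ` A)"
  have W: "set l \<subseteq> carrier G" if "l \<in> ?W" for l
    using that assms by (auto simp: lists_eq_set)
  have "x \<in> gprod ` ?W" if "x \<in> generate G A" for x
    using that
  proof induction
    case one
    show ?case by (rule rev_image_eqI[of "[]"]) auto
  next
    case (incl a)
    thus ?case using assms by (intro rev_image_eqI[of "[a]"]) auto
  next
    case (inv a)
    thus ?case using assms by (intro rev_image_eqI[of "[inv a]"]) auto
  next
    case (eng x y)
    then obtain l l' where "l \<in> ?W" "l' \<in> ?W" "x = gprod l" "y = gprod l'" by blast
    thus ?case using W by (intro rev_image_eqI[of "l @ l'"]) (auto simp: gprod_append)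
  qed
  hence "generate G A \<subseteq> gprod ` ?W" by auto
  moreover have "countable ?W" using assms(1) by (intro countable_lists) simp
  hence "countable (gprod ` ?W)" by (rule countable_image)
  ultimately show ?thesis by (rule countable_subset)
qed

section \<open>Invariance under an injective homomorphism on a subgroup\<close>

context
  fixes H :: "'a set" and G' :: "('c, 'd) monoid_scheme" and f :: "'a \<Rightarrow> 'c"
  assumes H: "subgroup H G" and G': "comm_group G'"
    and hom: "f \<in> hom (G\<lparr>carrier := H\<rparr>) G'" and inj: "inj_on f H"
begin

lemma H_carrier: "H \<subseteq> carrier G"
  using H by (rule subgroup.subset)

lemma f_closed: "x \<in> H \<Longrightarrow> f x \<in> carrier G'"
  using hom by (auto simp: hom_def)

lemma f_mult: "x \<in> H \<Longrightarrow> y \<in> H \<Longrightarrow> f (x \<otimes> y) = f x \<otimes>\<^bsub>G'\<^esub> f y"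
  using hom by (auto simp: hom_def)

lemma group_hom_f: "group_hom (G\<lparr>carrier := H\<rparr>) G' f"
  using subgroup.subgroup_is_group[OF H is_group] G' hom
  by (simp add: group_hom_def group_hom_axioms_def comm_group_def)

lemma f_one: "f \<one> = \<one>\<^bsub>G'\<^esub>"
  using group_hom.hom_one[OF group_hom_f] by simp

lemma f_int_pow: "x \<in> H \<Longrightarrow> f (x [^] (k :: int)) = f x [^]\<^bsub>G'\<^esub> k"
  using group_hom.hom_int_pow[OF group_hom_f, of x k] int_pow_consistent[OF H, of x k] by simp

text \<open>Membership in \<open>H\<close> is carried along in the induction, because
  \<open>f\<close> is multiplicative only there.\<close>

lemma f_finprod:
  assumes "finite L" "\<And>x. x \<in> L \<Longrightarrow> g x \<in> H"
  shows "finprod G g L \<in> H \<and> f (finprod G g L) = finprod G' (\<lambda>x. f (g x)) L"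
  using assms
proof (induction L)
  case empty
  interpret G': comm_group G' by (rule G')
  show ?case using subgroup.one_closed[OF H] f_one by simp
next
  case (insert x L)
  interpret G': comm_group G' by (rule G')
  have "finprod G g (insert x L) = g x \<otimes> finprod G g L"
    using insert H_carrier by (intro finprod_insert) auto
  moreover have "finprod G' (\<lambda>x. f (g x)) (insert x L) = f (g x) \<otimes>\<^bsub>G'\<^esub> finprod G' (\<lambda>x. f (g x)) L"
    using insert f_closed by (intro G'.finprod_insert) auto
  ultimately show ?case
    using insert subgroup.m_closed[OF H] f_mult by simp
qed

text \<open>Coefficients \<open>e\<close> on the image are pulled back to
  \<open>\<lambda>x. e (f x)\<close>, and injectivity brings the relation back to
  \<open>G\<close>.\<close>

lemma dissociated_image:
  assumes "L \<subseteq> H" "dissociated G L"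
  shows "dissociated G' (f ` L)"
  unfolding dissociated_def
proof (intro conjI allI impI)
  interpret G': comm_group G' by (rule G')
  have L: "finite L" using assms by (simp add: dissociated_def)
  show "finite (f ` L)" "f ` L \<subseteq> carrier G'" using L assms f_closed by auto
  fix e :: "'c \<Rightarrow> int"
  assume e: "(\<forall>y\<in>f ` L. e y \<in> {-1, 0, 1}) \<and> finprod G' (\<lambda>y. y [^]\<^bsub>G'\<^esub> e y) (f ` L) = \<one>\<^bsub>G'\<^esub>"
  have pow: "x [^] e (f x) \<in> H" if "x \<in> L" for x
    using that assms H by (auto intro: subgroup_int_pow_closed)
  have "finprod G' (\<lambda>y. y [^]\<^bsub>G'\<^esub> e y) (f ` L) = finprod G' (\<lambda>x. f x [^]\<^bsub>G'\<^esub> e (f x)) L"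
    using assms f_closed by (intro G'.finprod_reindex inj_on_subset[OF inj]) auto
  also have "\<dots> = finprod G' (\<lambda>x. f (x [^] e (f x))) L"
    using assms f_closed by (intro G'.finprod_cong') (auto simp: f_int_pow subset_iff)
  also have "\<dots> = f (finprod G (\<lambda>x. x [^] e (f x)) L)"
    using f_finprod[OF L pow] by simp
  finally have "f (finprod G (\<lambda>x. x [^] e (f x)) L) = f \<one>" using e f_one by simp
  hence "finprod G (\<lambda>x. x [^] e (f x)) L = \<one>"
    by (rule inj_onD[OF inj]) (use f_finprod[OF L pow] subgroup.one_closed[OF H] in simp_all)
  moreover have "\<forall>x\<in>L. e (f x) \<in> {-1, 0, 1}" using e by auto
  ultimately have "(\<forall>x\<in>L. e (f x) \<in> {-1, 0, 1}) \<and> finprod G (\<lambda>x. x [^] e (f x)) L = \<one>"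
    by (intro conjI)
  hence "\<forall>x\<in>L. e (f x) = 0"
    using assms(2)[unfolded dissociated_def, THEN conjunct2, THEN conjunct2, THEN spec[of _ "\<lambda>x. e (f x)"]]
    by (rule mp[rotated])
  thus "\<forall>y\<in>f ` L. e y = 0" by auto
qed

text \<open>The direction that carries an upper bound for the dimension from \<open>G'\<close> back
  to \<open>G\<close>.\<close>

lemma additive_dim_image_ge:
  assumes "finite B" "B \<subseteq> H"
  shows "additive_dim G B \<le> additive_dim G' (f ` B)"
proof -
  obtain L where L: "L \<subseteq> B" "dissociated G L" "card L = additive_dim G B"
    using additive_dim_attained[OF assms(1)] .
  have "card (f ` L) = card L"
    using L assms by (intro card_image inj_on_subset[OF inj]) auto
  moreover have "card (f ` L) \<le> additive_dim G' (f ` B)"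
    unfolding additive_dim_def
  proof (rule Max_ge)
    show "finite {card L |L. L \<subseteq> f ` B \<and> dissociated G' L}"
      using assms by (rule_tac finite_subset[of _ "card ` Pow (f ` B)"]) auto
    show "card (f ` L) \<in> {card L |L. L \<subseteq> f ` B \<and> dissociated G' L}"
      using L(1) dissociated_image[OF order.trans[OF L(1) assms(2)] L(2)]
      by (intro CollectI exI[of _ "f ` L"] conjI refl image_mono)
  qed
  ultimately show ?thesis using L by simp
qed

lemma additive_energy_image:
  assumes A: "A \<subseteq> H"
  shows "additive_energy G' (f ` A) = additive_energy G A"
proof -
  let ?T = "{(a1, a2, a3, a4). a1 \<in> A \<and> a2 \<in> A \<and> a3 \<in> A \<and> a4 \<in> A \<and> a1 \<otimes> a2 = a3 \<otimes> a4}"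
  let ?F = "map_prod f (map_prod f (map_prod f f))"
  have injA: "inj_on f A" using inj A by (rule inj_on_subset)
  have iff: "f a \<otimes>\<^bsub>G'\<^esub> f b = f c \<otimes>\<^bsub>G'\<^esub> f d \<longleftrightarrow> a \<otimes> b = c \<otimes> d"
    if "a \<in> A" "b \<in> A" "c \<in> A" "d \<in> A" for a b c d
  proof -
    have in_H: "a \<in> H" "b \<in> H" "c \<in> H" "d \<in> H" using that A by auto
    hence "f (a \<otimes> b) = f (c \<otimes> d) \<longleftrightarrow> a \<otimes> b = c \<otimes> d"
      by (intro inj_on_eq_iff[OF inj] subgroup.m_closed[OF H])
    thus ?thesis using in_H by (simp add: f_mult)
  qed
  let ?T' = "{(a1, a2, a3, a4). a1 \<in> f ` A \<and> a2 \<in> f ` A \<and> a3 \<in> f ` A \<and> a4 \<in> f ` A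
           \<and> a1 \<otimes>\<^bsub>G'\<^esub> a2 = a3 \<otimes>\<^bsub>G'\<^esub> a4}"
  have "?T' \<subseteq> ?F ` ?T"
  proof
    fix y assume y: "y \<in> ?T'"
    obtain a b c d where abcd: "a \<in> A" "b \<in> A" "c \<in> A" "d \<in> A" "y = (f a, f b, f c, f d)"
      and "f a \<otimes>\<^bsub>G'\<^esub> f b = f c \<otimes>\<^bsub>G'\<^esub> f d" using y by blast
    hence "(a, b, c, d) \<in> ?T" using iff by simp
    thus "y \<in> ?F ` ?T" by (rule rev_image_eqI) (simp add: abcd)
  qed
  moreover have "?F ` ?T \<subseteq> ?T'" by (auto simp: iff)
  ultimately have "?T' = ?F ` ?T" by (rule equalityI)
  moreover have "inj_on ?F (A \<times> A \<times> A \<times> A)"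
    using injA by (intro map_prod_inj_on)
  hence "inj_on ?F ?T" by (rule inj_on_subset) auto
  ultimately show ?thesis unfolding additive_energy_def by (simp add: card_image)
qed

end

end

text \<open>The subgroup generated by \<open>A\<close> is countable, so an enumeration transports it
  to a set of natural numbers; the set found there is pulled back along \<open>f\<close>.\<close>

lemma energy_dim_bounds_transfer:
  assumes "energy_dim_bounds TYPE(nat) c C"
  shows "energy_dim_bounds TYPE('a) c C"
  unfolding energy_dim_bounds_def
proof (intro allI impI)
  fix G :: "'a monoid" and A :: "'a set" and K :: real
  assume *: "comm_group G \<and> A \<subseteq> carrier G \<and> finite A \<and> card A \<ge> 2 \<and>
        real (additive_energy G A) = real (card A) ^ 3 / K"
  then interpret comm_group G by simp
  define H where "H = generate G A"
  define f where "f = to_nat_on H"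
  \<comment> \<open>\<open>image_group\<close> multiplies by choosing preimages under
    \<open>f\<close>; injectivity makes the result an isomorphic copy.\<close>
  define G' where "G' = image_group f (G\<lparr>carrier := H\<rparr>)"
  have H: "subgroup H G" unfolding H_def using * by (intro generate_is_subgroup) auto
  have AH: "A \<subseteq> H" by (auto simp: H_def intro: generate.incl)
  have "countable H" unfolding H_def using * by (intro countable_generate) (auto intro: countable_finite)
  hence inj: "inj_on f H" unfolding f_def by (rule inj_on_to_nat_on)
  have comm: "comm_group (G\<lparr>carrier := H\<rparr>)"
    using group.group_comm_groupI[OF subgroup.subgroup_is_group[OF H is_group]]
      subgroup.subset[OF H] m_comm by (simp add: subset_iff)
  have hom: "f \<in> hom (G\<lparr>carrier := H\<rparr>) G'"
    using inj_imp_image_group_iso[of f "G\<lparr>carrier := H\<rparr>"] inj by (simp add: G'_def iso_def)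
  have G': "comm_group G'"
    using comm_group.hom_imp_img_comm_group[OF comm hom] by (simp add: G'_def image_group_def)
  note image = H G' hom inj
  have injA: "inj_on f A" using inj AH by (rule inj_on_subset)
  have "f ` A \<subseteq> carrier G'" by (auto simp: G'_def image_group_def AH[THEN subsetD])
  moreover have "card (f ` A) = card A" using injA by (rule card_image)
  moreover have "additive_energy G' (f ` A) = additive_energy G A"
    by (rule additive_energy_image[OF image AH])
  ultimately have hyp: "comm_group G' \<and> f ` A \<subseteq> carrier G' \<and> finite (f ` A) \<and> card (f ` A) \<ge> 2 \<and>
      real (additive_energy G' (f ` A)) = real (card (f ` A)) ^ 3 / K"
    and card_fA: "card (f ` A) = card A" using * G' by simp_all
  obtain B' where B': "B' \<subseteq> f ` A" "real (card B') \<ge> c * real (card A) / K powr (25 / 8)"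
      "real (additive_dim G' B') \<le> C * K powr (7 / 8) * log 2 (real (card A))"
    using assms[unfolded energy_dim_bounds_def, THEN spec, THEN spec, THEN spec, THEN mp, OF hyp]
    unfolding card_fA by (elim exE conjE)
  then obtain B where B: "B \<subseteq> A" "B' = f ` B" by (auto elim: subset_imageE)
  have "card B' = card B"
    unfolding B(2) by (rule card_image[OF inj_on_subset[OF injA B(1)]])
  moreover have "additive_dim G B \<le> additive_dim G' B'"
    unfolding B(2) using B AH * by (intro additive_dim_image_ge[OF image]) (auto intro: finite_subset)
  ultimately show "\<exists>B\<subseteq>A. real (card B) \<ge> c * real (card A) / K powr (25 / 8) \<and>
           real (additive_dim G B) \<le> C * K powr (7 / 8) * log 2 (real (card A))"
    using B(1) B'(2,3) by (intro exI[of _ B] conjI) simp_all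
qed

theorem theorem20:
  "(\<exists>c>0. \<exists>C>0. energy_dim_bounds TYPE(nat) c C) \<and>
   (\<forall>c>0. \<forall>C>0. energy_dim_bounds TYPE(nat) c C \<longrightarrow> energy_dim_bounds TYPE('a) c C)"
proof
  show "\<exists>c>0. \<exists>C>0. energy_dim_bounds TYPE(nat) c C"
  proof (intro exI conjI)
    show "energy_dim_bounds TYPE(nat) (1 / 20000) (1600 * exp 5)"
      by (rule energy_dim_bounds_explicit)
  qed simp_all
qed (intro allI impI, erule energy_dim_bounds_transfer)

end
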